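(* Consider stochastic scheduling on unrelated machines in the online-list model, and let $\mathsf{ALG}$ denote the expected total weighted completion time $\mathbb{E}[\sum_{j} w_j C_j]$ of the Greedy Algorithm described in the context. Then for every instance, $\mathsf{ALG}\le (4+2\Delta)\,\mathsf{OPT}$, i.e. the Greedy Algorithm is $(4+2\Delta)$-competitive.
   Context: Model: a finite set $M$ of $m$ machines and a finite set $J$ of jobs. Each job $j$ has a weight $w_j\ge 0$ and, for each machine $i\in M$, a processing-time random variable $P_{ij}$ taking nonnegative integer values, with $\mathbb{E}[P_{ij}]\in(0,\infty]$ ($\mathbb{E}[P_{ij}]=\infty$ means $j$ cannot be processed on $i$). For a fixed job the variables $P_{ij}$, $i\in M$, may be dependent, but the vectors $(P_{ij})_{i\in M}$ of different jobs are independent. Each job must be processed nonpreemptively on exactly one machine; each machine processes at most one job at a time; if $j$ is processed on $i$ its processing time is the realization of $P_{ij}$, which is revealed only when $j$ completes. $C_j$ denotes the completion time of $j$. Define $\Delta:=\max_{i,j}\mathrm{Var}[P_{ij}]/\mathbb{E}[P_{ij}]^2$ (over pairs with finite expectation). $\mathsf{OPT}$ is the expected total weighted completion time $\mathbb{E}[\sum_j w_jC_j]$ of an optimal non-anticipatory scheduling policy (a policy whose decisions at time $t$ depend only on information available at time $t$, including realized processing times of completed jobs and elapsed processing times; it is not required to assign jobs to machines upon arrival). Online-list model: all jobs are available at time $0$ but are presented one by one in the order $1,2,\dots,|J|$; when job $j$ is presented (together with its weight and the distributions of $P_{ij}$), the algorithm must irrevocably assign it to a machine before the next job is presented; once all jobs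 have been presented, the jobs assigned to each machine are scheduled on it. Notation: for job $j$ and machine $i$, $H(j,i):=\{k\in J: w_k/\mathbb{E}[P_{ik}]>w_j/\mathbb{E}[P_{ij}]\}\cup\{k\in J: k\le j,\ w_k/\mathbb{E}[P_{ik}]=w_j/\mathbb{E}[P_{ij}]\}$ and $L(j,i):=J\setminus H(j,i)$. Write $k\to i$ if job $k$ has been assigned to machine $i$ by the algorithm. Greedy Algorithm: when job $j$ is presented, compute for each machine $i$ $$\mathrm{incr}(j\to i):=w_j\sum_{k\to i,\,k\le j,\,k\in H(j,i)}\mathbb{E}[P_{ik}]\;+\;\mathbb{E}[P_{ij}]\sum_{k\to i,\,k<j,\,k\in L(j,i)}w_k,$$ where in the first sum $j$ itself is counted as if assigned to $i$; assign $j$ to a machine minimizing $\mathrm{incr}(j\to i)$ (ties broken arbitrarily). After all jobs are assigned, each machine processes its jobs without idle time in non-increasing order of $w_k/\mathbb{E}[P_{ik}]$ (ties by index). *)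

theory Defs
  imports "HOL-Probability.Probability"
begin

(* The jobs are 1, ..., njobs I, numbered in the order in which they are presented;
   ptime I i j is the processing time of job j on machine i. *)
record ('a, 'm) sched_inst =
  probs :: "'a measure"
  machines :: "'m set"
  njobs :: nat
  weight :: "nat \<Rightarrow> real"
  ptime :: "'m \<Rightarrow> nat \<Rightarrow> 'a \<Rightarrow> nat"

definition jobs :: "('a, 'm) sched_inst \<Rightarrow> nat set" where
  "jobs I = {1..njobs I}"

definition mean :: "('a, 'm) sched_inst \<Rightarrow> 'm \<Rightarrow> nat \<Rightarrow> ennreal" where
  "mean I i j = (\<integral>\<^sup>+ \<omega>. of_nat (ptime I i j \<omega>) \<partial>probs I)"

(* Only used for pairs with finite mean. Unlike the Bochner integral behind
   prob_space.variance, this is top, not 0, if the second moment is infinite. *)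
definition var :: "('a, 'm) sched_inst \<Rightarrow> 'm \<Rightarrow> nat \<Rightarrow> ennreal" where
  "var I i j =
     (\<integral>\<^sup>+ \<omega>. ennreal ((real (ptime I i j \<omega>) - enn2real (mean I i j))\<^sup>2) \<partial>probs I)"

definition valid_inst :: "('a, 'm) sched_inst \<Rightarrow> bool" where
  "valid_inst I \<longleftrightarrow>
     prob_space (probs I) \<and>
     finite (machines I) \<and>
     (\<forall>j\<in>jobs I. 0 \<le> weight I j) \<and>
     (\<forall>i\<in>machines I. \<forall>j\<in>jobs I. ptime I i j \<in> measurable (probs I) (count_space UNIV)) \<and>
     (\<forall>i\<in>machines I. \<forall>j\<in>jobs I. 0 < mean I i j) \<and>
     prob_space.indep_vars (probs I) (\<lambda>j. \<Pi>\<^sub>M i\<in>machines I. count_space UNIV)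
       (\<lambda>j \<omega>. \<lambda>i\<in>machines I. ptime I i j \<omega>) (jobs I)"

(* An infinite mean encodes that the job cannot be processed on the machine. *)
definition eligible :: "('a, 'm) sched_inst \<Rightarrow> nat \<Rightarrow> 'm set" where
  "eligible I j = {i \<in> machines I. mean I i j < top}"

definition Delta :: "('a, 'm) sched_inst \<Rightarrow> ennreal" where
  "Delta I = (SUP (i, j)\<in>{(i, j). j \<in> jobs I \<and> i \<in> eligible I j}. var I i j / (mean I i j)\<^sup>2)"


section \<open>Non-anticipatory policies\<close>

datatype 'm event = Start real nat 'm | Complete real nat

(* All events so far, latest first. *)
type_synonym 'm history = "'m event list"

(* The value of a policy at a history is the plan made right after the latest event of the history:
   Some (t, j, i) means to start job j on machine i at time t, provided that no running job
   completes at or before time t; None means to start nothing before the next completion. If a job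
   completes first, the policy makes a new plan, knowing about this completion. Between two events
   nothing is observed except the passing of time without a completion, so this captures every
   policy whose decisions at time t depend only on the information available at time t. *)
type_synonym 'm policy = "'m history \<Rightarrow> (real \<times> nat \<times> 'm) option"

primrec event_time :: "'m event \<Rightarrow> real" where
  "event_time (Start t j i) = t"
| "event_time (Complete t j) = t"

fun now :: "'m history \<Rightarrow> real" where
  "now [] = 0"
| "now (e # h) = event_time e"

definition started :: "'m history \<Rightarrow> nat set" where
  "started h = {j. \<exists>t i. Start t j i \<in> set h}"

definition running :: "'m history \<Rightarrow> (real \<times> nat \<times> 'm) set" where
  "running h = {(s, j, i). Start s j i \<in> set h \<and> (\<forall>c. Complete c j \<notin> set h)}"

(* The end of the first running job(s) under the realization p of the processing times. *)
definition next_end :: "('m \<Rightarrow> nat \<Rightarrow> nat) \<Rightarrow> 'm history \<Rightarrow> real" where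
  "next_end p h = Min ((\<lambda>(s, j, i). s + real (p i j)) ` running h)"

(* Simultaneous completions are recorded one after the other. Since completions precede starts at
   the same time, all of them are known before the next start. *)
definition next_completion :: "('m \<Rightarrow> nat \<Rightarrow> nat) \<Rightarrow> 'm history \<Rightarrow> 'm event" where
  "next_completion p h =
     Complete (next_end p h)
       (LEAST j. \<exists>s i. (s, j, i) \<in> running h \<and> s + real (p i j) = next_end p h)"

definition next_event :: "'m policy \<Rightarrow> ('m \<Rightarrow> nat \<Rightarrow> nat) \<Rightarrow> 'm history \<Rightarrow> 'm event" where
  "next_event \<pi> p h =
     (case \<pi> h of
        None \<Rightarrow> next_completion p h
      | Some (t, j, i) \<Rightarrow>
          if running h \<noteq> {} \<and> next_end p h \<le> t then next_completion p h else Start t j i)"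

primrec run :: "'m policy \<Rightarrow> ('m \<Rightarrow> nat \<Rightarrow> nat) \<Rightarrow> nat \<Rightarrow> 'm history" where
  "run \<pi> p 0 = []"
| "run \<pi> p (Suc m) = next_event \<pi> p (run \<pi> p m) # run \<pi> p m"

definition realization :: "('a, 'm) sched_inst \<Rightarrow> 'a \<Rightarrow> 'm \<Rightarrow> nat \<Rightarrow> nat" where
  "realization I \<omega> = (\<lambda>i j. ptime I i j \<omega>)"

definition feasible_plan ::
  "('a, 'm) sched_inst \<Rightarrow> 'm history \<Rightarrow> (real \<times> nat \<times> 'm) option \<Rightarrow> bool" where
  "feasible_plan I h d \<longleftrightarrow>
     (case d of
        None \<Rightarrow> running h \<noteq> {}
      | Some (t, j, i) \<Rightarrow>
          now h \<le> t \<and> j \<in> jobs I - started h \<and> i \<in> eligible I j \<and>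
          (\<forall>s k. (s, k, i) \<notin> running h))"

(* A complete schedule consists of 2 * njobs I events, a start and a completion for every job.
   Feasibility of all plans up to there guarantees that all jobs get processed. *)
definition feasible_policy :: "('a, 'm) sched_inst \<Rightarrow> 'm policy \<Rightarrow> bool" where
  "feasible_policy I \<pi> \<longleftrightarrow>
     (\<forall>\<omega>\<in>space (probs I). \<forall>m < 2 * njobs I.
        let h = run \<pi> (realization I \<omega>) m in feasible_plan I h (\<pi> h))"

definition policy_completion :: "('a, 'm) sched_inst \<Rightarrow> 'm policy \<Rightarrow> 'a \<Rightarrow> nat \<Rightarrow> real" where
  "policy_completion I \<pi> \<omega> j =
     (THE c. Complete c j \<in> set (run \<pi> (realization I \<omega>) (2 * njobs I)))"

definition policy_cost :: "('a, 'm) sched_inst \<Rightarrow> 'm policy \<Rightarrow> ennreal" where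
  "policy_cost I \<pi> =
     (\<integral>\<^sup>+ \<omega>. ennreal (\<Sum>j\<in>jobs I. weight I j * policy_completion I \<pi> \<omega> j) \<partial>probs I)"

definition OPT :: "('a, 'm) sched_inst \<Rightarrow> ennreal" where
  "OPT I = (INF \<pi>\<in>{\<pi>. feasible_policy I \<pi>}. policy_cost I \<pi>)"


section \<open>The greedy algorithm\<close>

(* The quotient is 0 if the mean is infinite. *)
definition ratio :: "('a, 'm) sched_inst \<Rightarrow> 'm \<Rightarrow> nat \<Rightarrow> ennreal" where
  "ratio I i j = ennreal (weight I j) / mean I i j"

definition H :: "('a, 'm) sched_inst \<Rightarrow> nat \<Rightarrow> 'm \<Rightarrow> nat set" where
  "H I j i = {k \<in> jobs I. ratio I i k > ratio I i j} \<union>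
             {k \<in> jobs I. k \<le> j \<and> ratio I i k = ratio I i j}"

definition L :: "('a, 'm) sched_inst \<Rightarrow> nat \<Rightarrow> 'm \<Rightarrow> nat set" where
  "L I j i = jobs I - H I j i"

(* a k is the machine to which job k has been assigned; only the values for k < j matter. *)
definition incr :: "('a, 'm) sched_inst \<Rightarrow> (nat \<Rightarrow> 'm) \<Rightarrow> nat \<Rightarrow> 'm \<Rightarrow> ennreal" where
  "incr I a j i =
     ennreal (weight I j) *
       (\<Sum>k | k \<in> H I j i \<and> k \<le> j \<and> (k = j \<or> a k = i). mean I i k) +
     mean I i j * (\<Sum>k | k \<in> L I j i \<and> k < j \<and> a k = i. ennreal (weight I k))"

(* The restriction to eligible machines matters for jobs of weight 0 only, because 0 * top = 0.
   Every way of breaking ties corresponds to one such assignment a. *)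
definition greedy_assignment :: "('a, 'm) sched_inst \<Rightarrow> (nat \<Rightarrow> 'm) \<Rightarrow> bool" where
  "greedy_assignment I a \<longleftrightarrow>
     (\<forall>j\<in>jobs I. is_arg_min (incr I a j) (\<lambda>i. i \<in> eligible I j) (a j))"

(* On machine i, the jobs processed up to and including j are exactly those in H I j i that are
   assigned to i, and there is no idle time. *)
definition greedy_completion :: "('a, 'm) sched_inst \<Rightarrow> (nat \<Rightarrow> 'm) \<Rightarrow> 'a \<Rightarrow> nat \<Rightarrow> real" where
  "greedy_completion I a \<omega> j = (\<Sum>k | k \<in> H I j (a j) \<and> a k = a j. real (ptime I (a j) k \<omega>))"

definition ALG :: "('a, 'm) sched_inst \<Rightarrow> (nat \<Rightarrow> 'm) \<Rightarrow> ennreal" where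
  "ALG I a =
     (\<integral>\<^sup>+ \<omega>. ennreal (\<Sum>j\<in>jobs I. weight I j * greedy_completion I a \<omega> j) \<partial>probs I)"

end

(* Idea: let D_k be the time at which job k would end if all processing times were equal to their
   means and the greedy assignment were used. Then ALG = sum_k w_k D_k, which is also the sum of the
   greedy increases. For every machine i and time s, the increase of j is at most
   w_j E[P_ij] + w_j s + E[P_ij] B_i(s), where B_i(s) is the weight of the jobs k on i with D_k > s.
   Take this at time 2s, divide by E[P_ij], and integrate over the times s at which an arbitrary
   policy processes j. By non-anticipation the start of j is independent of its processing times, so
   in expectation the left-hand side becomes the increase of j and the terms with w_j become at most
   (2 + Delta) w_j E[C_j]. As no two jobs overlap on a machine, the remaining terms add up to at most
   the sum over i of the integral of B_i(2s), which is ALG / 2. *)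

theory Submission
  imports Defs
begin

section \<open>Runs of feasible policies\<close>

text \<open>Why time 2 s: with a factor c > 1 instead of 2, the terms in w_j average to at most w_j
  (c t + (1 + c (1 + Delta) / 2) m), where t is the start of j and m its mean on the chosen machine,
  and the backlog contributes ALG / c. So ALG is at most c / (c - 1) times max (c, 1 + c (1 + Delta)
  / 2) times the cost of the policy. For Delta = 0 the choice c = 2 makes the two entries of the
  maximum equal and is optimal; in general it gives 2 (2 + Delta). A policy is an arbitrary
  function, so measurability of its start times cannot be taken for granted. Measurability and
  independence both come from one fact: the start of j is a function of the processing times of the
  other jobs, and these take only countably many values. Second moments, and hence
  \<open>Delta I\<close>, may be infinite. The estimates are therefore carried out in ennreal, where
  differences are avoided and the absorption of ALG / 2 rests on the finiteness of ALG.\<close>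

lemma finite_running: "finite (running h)"
proof (rule finite_subset)
  show "running h \<subseteq> (\<lambda>e. case e of Start s j i \<Rightarrow> (s, j, i)) ` set h"
    by (force simp: running_def)
qed simp

lemma next_completion_running:
  assumes "running h \<noteq> {}"
  obtains s j i where "(s, j, i) \<in> running h" "next_completion p h = Complete (s + real (p i j)) j"
    "\<And>s' j' i'. (s', j', i') \<in> running h \<Longrightarrow> s + real (p i j) \<le> s' + real (p i' j')"
proof -
  let ?E = "(\<lambda>(s, j, i). s + real (p i j)) ` running h"
  let ?P = "\<lambda>j. \<exists>s i. (s, j, i) \<in> running h \<and> s + real (p i j) = next_end p h"
  have E: "finite ?E" "?E \<noteq> {}"
    using assms finite_running[of h] by auto
  from Min_in[OF E] have "\<exists>j. ?P j"
    unfolding next_end_def by force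
  then have "?P (LEAST j. ?P j)"
    by (rule LeastI_ex)
  then obtain s i where si: "(s, (LEAST j. ?P j), i) \<in> running h"
      "s + real (p i (LEAST j. ?P j)) = next_end p h"
    by blast
  have "next_end p h \<le> s' + real (p i' j')" if "(s', j', i') \<in> running h" for s' j' i'
    unfolding next_end_def using E that by (intro Min_le) force+
  with si show ?thesis
    by (intro that[of s "LEAST j. ?P j" i]) (simp_all add: next_completion_def)
qed

text \<open>Invariant of a run. That no running job is overdue keeps event times monotone when the
  first completion is recorded. That a recorded completion equals start plus processing time carries
  the disjointness of periods over to the next start on the same machine.\<close>

definition partial_schedule ::
  "('a, 'm) sched_inst \<Rightarrow> ('m \<Rightarrow> nat \<Rightarrow> nat) \<Rightarrow> 'm history \<Rightarrow> bool" where
  "partial_schedule I p h \<longleftrightarrow>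
     0 \<le> now h \<and> distinct h \<and>
     (\<forall>t j i. Start t j i \<in> set h \<longrightarrow> j \<in> jobs I \<and> i \<in> eligible I j \<and> 0 \<le> t \<and> t \<le> now h) \<and>
     (\<forall>t j i t' i'. Start t j i \<in> set h \<longrightarrow> Start t' j i' \<in> set h \<longrightarrow> t = t' \<and> i = i') \<and>
     (\<forall>c j. Complete c j \<in> set h \<longrightarrow>
        c \<le> now h \<and> (\<exists>s i. Start s j i \<in> set h \<and> c = s + real (p i j))) \<and>
     (\<forall>s j i. (s, j, i) \<in> running h \<longrightarrow> now h \<le> s + real (p i j)) \<and>
     (\<forall>s j s' k i. Start s j i \<in> set h \<longrightarrow> Start s' k i \<in> set h \<longrightarrow> j \<noteq> k \<longrightarrow>
        s + real (p i j) \<le> s' \<or> s' + real (p i k) \<le> s)"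

lemma partial_scheduleD:
  assumes "partial_schedule I p h"
  shows "0 \<le> now h" "distinct h"
    "Start t j i \<in> set h \<Longrightarrow> j \<in> jobs I"
    "Start t j i \<in> set h \<Longrightarrow> i \<in> eligible I j"
    "Start t j i \<in> set h \<Longrightarrow> 0 \<le> t"
    "Start t j i \<in> set h \<Longrightarrow> t \<le> now h"
    "Start t j i \<in> set h \<Longrightarrow> Start t' j i' \<in> set h \<Longrightarrow> t = t' \<and> i = i'"
    "Complete c j \<in> set h \<Longrightarrow> c \<le> now h"
    "Complete c j \<in> set h \<Longrightarrow> \<exists>s i. Start s j i \<in> set h \<and> c = s + real (p i j)"
    "(s, j, i) \<in> running h \<Longrightarrow> now h \<le> s + real (p i j)"
    "Start s j i \<in> set h \<Longrightarrow> Start s' k i \<in> set h \<Longrightarrow> j \<noteq> k \<Longrightarrow>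
        s + real (p i j) \<le> s' \<or> s' + real (p i k) \<le> s"
  using assms unfolding partial_schedule_def by blast+

lemma partial_schedule_Start:
  assumes h: "partial_schedule I p h"
    and t: "now h \<le> t" "\<And>s k l. (s, k, l) \<in> running h \<Longrightarrow> t \<le> s + real (p l k)"
    and j: "j \<in> jobs I" "j \<notin> started h" "i \<in> eligible I j"
    and i: "\<And>s k. (s, k, i) \<notin> running h"
  shows "partial_schedule I p (Start t j i # h)"
proof -
  note D = partial_scheduleD[OF h]
  have nS: "Start t' j i' \<notin> set h" for t' i'
    using j by (auto simp: started_def)
  have nC: "Complete c j \<notin> set h" for c
    using D(9)[of c j] nS by blast
  have run: "running (Start t j i # h) = insert (t, j, i) (running h)"
    using nC by (auto simp: running_def)
  \<comment> \<open>Machine i is idle, so every job started on it earlier has completed, and this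
    happened by \<open>now h \<le> t\<close>. Hence the new period cannot overlap the earlier
    ones.\<close>
  have before: "s + real (p i k) \<le> t" if "Start s k i \<in> set h" for s k
  proof -
    from i[of s k] that obtain c where c: "Complete c k \<in> set h"
      by (auto simp: running_def)
    from D(9)[OF this] obtain s' i' where "Start s' k i' \<in> set h" "c = s' + real (p i' k)"
      by auto
    with D(7)[OF that this(1)] have "c = s + real (p i k)"
      by simp
    with D(8)[OF c] t(1) show ?thesis by simp
  qed
  show ?thesis
    unfolding partial_schedule_def run
  proof (intro conjI allI impI)
    show "0 \<le> now (Start t j i # h)" "distinct (Start t j i # h)"
      using D(1,2) t nS by auto
  next
    fix c k assume "Complete c k \<in> set (Start t j i # h)"
    then show "c \<le> now (Start t j i # h)"
      "\<exists>s l. Start s k l \<in> set (Start t j i # h) \<and> c = s + real (p l k)"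
      using D(8)[of c k] D(9)[of c k] t(1) by auto
  next
    fix s k l assume "(s, k, l) \<in> insert (t, j, i) (running h)"
    then show "now (Start t j i # h) \<le> s + real (p l k)"
      using t by auto
  next
    fix s k s' k' l assume "Start s k l \<in> set (Start t j i # h)"
      "Start s' k' l \<in> set (Start t j i # h)" "k \<noteq> k'"
    then show "s + real (p l k) \<le> s' \<or> s' + real (p l k') \<le> s"
      using before D(11)[of s k l s' k'] by auto
  next
    fix s k l assume "Start s k l \<in> set (Start t j i # h)"
    then show "k \<in> jobs I" "l \<in> eligible I k" "0 \<le> s" "s \<le> now (Start t j i # h)"
      using D(1) D(3-6)[of s k l] t j by auto
  next
    fix s k l s' l' assume "Start s k l \<in> set (Start t j i # h)" "Start s' k l' \<in> set (Start t j i # h)"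
    then show "s = s'" "l = l'"
      using nS D(7)[of s k l s' l'] by auto
  qed
qed

lemma partial_schedule_Complete:
  assumes h: "partial_schedule I p h" and j: "(s, j, i) \<in> running h"
    and first: "\<And>s' k l. (s', k, l) \<in> running h \<Longrightarrow> s + real (p i j) \<le> s' + real (p l k)"
  shows "partial_schedule I p (Complete (s + real (p i j)) j # h)"
proof -
  note D = partial_scheduleD[OF h]
  let ?e = "Complete (s + real (p i j)) j"
  have run: "running (?e # h) \<subseteq> running h"
    by (auto simp: running_def)
  have S: "Start s j i \<in> set h" and C: "Complete c j \<notin> set h" for c
    using j by (auto simp: running_def)
  note now = D(10)[OF j]
  show ?thesis
    unfolding partial_schedule_def
  proof (intro conjI allI impI)
    show "0 \<le> now (?e # h)" "distinct (?e # h)"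
      using D(1,2) C now by auto
  next
    fix c k assume "Complete c k \<in> set (?e # h)"
    then show "c \<le> now (?e # h)" "\<exists>s l. Start s k l \<in> set (?e # h) \<and> c = s + real (p l k)"
      using D(8)[of c k] D(9)[of c k] now S by auto
  next
    fix s' k l assume "(s', k, l) \<in> running (?e # h)"
    then show "now (?e # h) \<le> s' + real (p l k)"
      using run first by auto
  next
    fix s k s' k' l assume "Start s k l \<in> set (?e # h)" "Start s' k' l \<in> set (?e # h)" "k \<noteq> k'"
    then show "s + real (p l k) \<le> s' \<or> s' + real (p l k') \<le> s"
      using D(11)[of s k l s' k'] by auto
  next
    fix s' k l assume "Start s' k l \<in> set (?e # h)"
    then show "k \<in> jobs I" "l \<in> eligible I k" "0 \<le> s'" "s' \<le> now (?e # h)"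
      using D(3-6)[of s' k l] now by auto
  next
    fix s k l s' l' assume "Start s k l \<in> set (?e # h)" "Start s' k l' \<in> set (?e # h)"
    then show "s = s'" "l = l'"
      using D(7)[of s k l s' l'] by auto
  qed
qed

lemma partial_schedule_next_event:
  assumes h: "partial_schedule I p h" and plan: "feasible_plan I h (\<pi> h)"
  shows "partial_schedule I p (next_event \<pi> p h # h)"
\<comment> \<open>A completion can come next because the plan is \<open>None\<close> or because a
  planned start is overtaken; splitting by the event treats both at once. With no running job,
  \<open>next_end\<close> would be the minimum of an empty set and the event meaningless.\<close>
proof (cases "next_event \<pi> p h = next_completion p h \<and> running h \<noteq> {}")
  case True
  then have "running h \<noteq> {}" and eq: "next_event \<pi> p h = next_completion p h" by auto
  from this(1) obtain s j i where "(s, j, i) \<in> running h"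
    "next_completion p h = Complete (s + real (p i j)) j"
    "\<And>s' j' i'. (s', j', i') \<in> running h \<Longrightarrow> s + real (p i j) \<le> s' + real (p i' j')"
    by (rule next_completion_running[of h p]) blast
  then show ?thesis
    unfolding eq by (simp add: partial_schedule_Complete[OF h])
next
  case False
  have "\<pi> h \<noteq> None"
  proof
    assume "\<pi> h = None"
    with False plan show False by (simp add: feasible_plan_def next_event_def)
  qed
  then obtain t j i where tji: "\<pi> h = Some (t, j, i)"
    by (cases "\<pi> h") auto
  have not_due: "\<not> (running h \<noteq> {} \<and> next_end p h \<le> t)"
  proof
    assume due: "running h \<noteq> {} \<and> next_end p h \<le> t"
    then have "next_event \<pi> p h = next_completion p h"
      unfolding next_event_def tji option.case prod.case by (rule if_P)
    with False due show False by blast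
  qed
  then have nx: "next_event \<pi> p h = Start t j i"
    unfolding next_event_def tji option.case prod.case by (rule if_not_P)
  have "t \<le> s + real (p l k)" if "(s, k, l) \<in> running h" for s k l
  proof -
    have "next_end p h \<le> s + real (p l k)"
      unfolding next_end_def using finite_running[of h] that by (intro Min_le) force+
    with not_due that show ?thesis by auto
  qed
  with plan tji show ?thesis
    unfolding nx by (intro partial_schedule_Start[OF h]) (auto simp: feasible_plan_def)
qed

lemma partial_schedule_run:
  assumes "feasible_policy I \<pi>" "\<omega> \<in> space (probs I)" "m \<le> 2 * njobs I"
  shows "partial_schedule I (realization I \<omega>) (run \<pi> (realization I \<omega>) m)"
  using assms(3)
proof (induction m)
  case 0
  then show ?case by (simp add: partial_schedule_def running_def)
next
  case (Suc m)
  with assms(1,2) show ?case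
    by (auto simp: feasible_policy_def Let_def intro: partial_schedule_next_event)
qed

lemma length_run [simp]: "length (run \<pi> p m) = m"
  by (induction m) auto

text \<open>Counting: the events are distinct and a job has at most one start and one completion, so
  \<open>job\<close> embeds 2 * njobs I events into a set of 2 * njobs I pairs. The embedding is
  therefore onto, and every job has both events.\<close>

lemma partial_schedule_full:
  assumes h: "partial_schedule I p h" and len: "length h = 2 * njobs I" and j: "j \<in> jobs I"
  shows "\<exists>s i. Start s j i \<in> set h \<and> Complete (s + real (p i j)) j \<in> set h"
proof -
  note D = partial_scheduleD[OF h]
  define job where "job e = (case e of Start t j i \<Rightarrow> (True, j) | Complete c j \<Rightarrow> (False, j))"
    for e :: "'b event"
  have "inj_on job (set h)"
  proof (rule inj_onI)
    fix e e' assume *: "e \<in> set h" "e' \<in> set h" "job e = job e'"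
    show "e = e'"
    proof (cases e)
      case (Start t k i)
      with * D(7) show ?thesis by (cases e') (auto simp: job_def)
    next
      case (Complete c k)
      with * obtain c' where "e' = Complete c' k"
        by (cases e') (auto simp: job_def)
      have "\<exists>s i. Start s k i \<in> set h \<and> c = s + real (p i k)"
        "\<exists>s i. Start s k i \<in> set h \<and> c' = s + real (p i k)"
        using * Complete \<open>e' = _\<close> by (auto intro: D(9))
      then have "c = c'"
        using D(7) by metis
      with Complete \<open>e' = _\<close> show ?thesis by simp
    qed
  qed
  then have "card (job ` set h) = 2 * njobs I"
    using D(2) len by (simp add: card_image distinct_card)
  moreover have "job ` set h \<subseteq> UNIV \<times> jobs I"
  proof (rule image_subsetI)
    fix e assume e: "e \<in> set h"
    show "job e \<in> UNIV \<times> jobs I"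
    proof (cases e)
      case (Start t j i)
      with e D(3) show ?thesis by (auto simp: job_def)
    next
      case (Complete c j)
      with e D(9)[of c j] D(3) show ?thesis by (auto simp: job_def)
    qed
  qed
  ultimately have "job ` set h = UNIV \<times> jobs I"
    by (intro card_subset_eq) (auto simp: jobs_def card_cartesian_product)
  with j have "(True, j) \<in> job ` set h" "(False, j) \<in> job ` set h"
    by auto
  then obtain c where c: "Complete c j \<in> set h"
    by (auto simp: job_def split: event.splits)
  from D(9)[OF c] obtain s i where "Start s j i \<in> set h" "c = s + real (p i j)" by blast
  with c show ?thesis by blast
qed

text \<open>Histories grow at the head, so searching the tail first makes a start, once found,
  immune to later events. \<open>start_of_run_cong\<close> relies on this.\<close>

primrec start_of :: "nat \<Rightarrow> 'm history \<Rightarrow> (real \<times> 'm) option" where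
  "start_of j [] = None"
| "start_of j (e # h) =
     (case start_of j h of
        Some x \<Rightarrow> Some x
      | None \<Rightarrow> (case e of Start t k i \<Rightarrow> if k = j then Some (t, i) else None | Complete c k \<Rightarrow> None))"

lemma start_of_SomeD: "start_of j h = Some (t, i) \<Longrightarrow> Start t j i \<in> set h"
  by (induction h) (auto split: option.splits event.splits if_splits)

lemma start_of_NoneD: "start_of j h = None \<Longrightarrow> Start t j i \<notin> set h"
  by (induction h) (auto split: option.splits event.splits if_splits)

lemma next_event_cong:
  assumes "\<And>s j i. (s, j, i) \<in> running h \<Longrightarrow> p i j = p' i j"
  shows "next_event \<pi> p h = next_event \<pi> p' h"
proof -
  have E: "next_end p h = next_end p' h"
    unfolding next_end_def using assms by (intro arg_cong[where f = Min] image_cong) auto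
  have "next_completion p h = next_completion p' h"
  proof -
    have "(s, j, i) \<in> running h \<and> s + real (p i j) = x \<longleftrightarrow>
        (s, j, i) \<in> running h \<and> s + real (p' i j) = x" for s j i x
      using assms by auto
    then show ?thesis
      unfolding next_completion_def E by (simp only:)
  qed
  with E show ?thesis
    by (simp add: next_event_def split: option.split)
qed

text \<open>The start of a job does not depend on its own processing times: this is the only use
  made of non-anticipation.\<close>

lemma start_of_run_cong:
  assumes "\<And>m' s k i. m' < m \<Longrightarrow> (s, k, i) \<in> running (run \<pi> p m') \<Longrightarrow> k \<noteq> j \<Longrightarrow> p i k = p' i k"
  shows "start_of j (run \<pi> p m) = start_of j (run \<pi> p' m) \<and>
    (start_of j (run \<pi> p m) = None \<longrightarrow> run \<pi> p m = run \<pi> p' m)"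
  using assms
proof (induction m)
  case 0
  then show ?case by simp
next
  case (Suc m)
  then have IH: "start_of j (run \<pi> p m) = start_of j (run \<pi> p' m)"
    "start_of j (run \<pi> p m) = None \<Longrightarrow> run \<pi> p m = run \<pi> p' m"
    using less_SucI by blast+
  \<comment> \<open>Until j starts the two runs coincide, because only running jobs influence the
    next event and j is not among them. Once j has started the runs may diverge, but its recorded
    start is frozen.\<close>
  show ?case
  proof (cases "start_of j (run \<pi> p m)")
    case None
    then have eq: "run \<pi> p m = run \<pi> p' m" by (rule IH)
    have "p i k = p' i k" if r: "(s, k, i) \<in> running (run \<pi> p m)" for s k i
    proof -
      from r have "Start s k i \<in> set (run \<pi> p m)"
        by (auto simp: running_def)
      with start_of_NoneD[OF None] have "k \<noteq> j" by blast
      with Suc.prems[of m] r show ?thesis by simp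
    qed
    then have "next_event \<pi> p (run \<pi> p m) = next_event \<pi> p' (run \<pi> p m)"
      by (rule next_event_cong)
    with eq show ?thesis by simp
  next
    case (Some x)
    with IH(1) have "start_of j (run \<pi> p' m) = Some x" by simp
    with Some show ?thesis by simp
  qed
qed

section \<open>Start, machine and completion of a job under a feasible policy\<close>

definition start_time :: "('a, 'm) sched_inst \<Rightarrow> 'm policy \<Rightarrow> nat \<Rightarrow> 'a \<Rightarrow> real" where
  "start_time I \<pi> j \<omega> = fst (the (start_of j (run \<pi> (realization I \<omega>) (2 * njobs I))))"

definition machine :: "('a, 'm) sched_inst \<Rightarrow> 'm policy \<Rightarrow> nat \<Rightarrow> 'a \<Rightarrow> 'm" where
  "machine I \<pi> j \<omega> = snd (the (start_of j (run \<pi> (realization I \<omega>) (2 * njobs I))))"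

context
  fixes I :: "('a, 'm) sched_inst" and \<pi> :: "'m policy" and \<omega> :: 'a
  assumes feasible: "feasible_policy I \<pi>" and \<omega>: "\<omega> \<in> space (probs I)"
begin

lemma Start_machine:
  assumes "j \<in> jobs I"
  shows "Start (start_time I \<pi> j \<omega>) j (machine I \<pi> j \<omega>) \<in> set (run \<pi> (realization I \<omega>) (2 * njobs I))"
proof -
  let ?h = "run \<pi> (realization I \<omega>) (2 * njobs I)"
  have "\<exists>s i. Start s j i \<in> set ?h"
    using partial_schedule_full[OF partial_schedule_run[OF feasible \<omega> order_refl] _ assms] by auto
  then obtain s i where "start_of j ?h = Some (s, i)"
    using start_of_NoneD[of j ?h] by (cases "start_of j ?h") auto
  with start_of_SomeD[OF this] show ?thesis
    by (simp add: start_time_def machine_def)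
qed

lemma machine_eligible: "j \<in> jobs I \<Longrightarrow> machine I \<pi> j \<omega> \<in> eligible I j"
  and start_time_nonneg: "j \<in> jobs I \<Longrightarrow> 0 \<le> start_time I \<pi> j \<omega>"
  using partial_scheduleD(4,5)[OF partial_schedule_run[OF feasible \<omega> order_refl] Start_machine] by auto

lemma policy_completion_eq:
  assumes "j \<in> jobs I"
  shows "policy_completion I \<pi> \<omega> j = start_time I \<pi> j \<omega> + real (ptime I (machine I \<pi> j \<omega>) j \<omega>)"
proof -
  let ?h = "run \<pi> (realization I \<omega>) (2 * njobs I)"
  have h: "partial_schedule I (realization I \<omega>) ?h"
    by (rule partial_schedule_run[OF feasible \<omega> order_refl])
  note D = partial_scheduleD[OF h]
  from partial_schedule_full[OF h _ assms] obtain s i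
    where si: "Start s j i \<in> set ?h" "Complete (s + real (realization I \<omega> i j)) j \<in> set ?h" by auto
  have eq: "s = start_time I \<pi> j \<omega>" "i = machine I \<pi> j \<omega>"
    using D(7)[OF si(1) Start_machine[OF assms]] by auto
  have uniq: "c = s + real (realization I \<omega> i j)" if "Complete c j \<in> set ?h" for c
  proof -
    from D(9)[OF that] obtain s' i'
      where "Start s' j i' \<in> set ?h" "c = s' + real (realization I \<omega> i' j)" by blast
    with D(7)[OF si(1) this(1)] show ?thesis by simp
  qed
  have "policy_completion I \<pi> \<omega> j = s + real (realization I \<omega> i j)"
    unfolding policy_completion_def using si(2) by (rule the_equality) (rule uniq)
  with eq show ?thesis by (simp add: realization_def)
qed

lemma machine_disjoint:
  assumes "j \<in> jobs I" "k \<in> jobs I" "j \<noteq> k" "machine I \<pi> j \<omega> = machine I \<pi> k \<omega>"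
  shows "policy_completion I \<pi> \<omega> j \<le> start_time I \<pi> k \<omega> \<or>
    policy_completion I \<pi> \<omega> k \<le> start_time I \<pi> j \<omega>"
  using partial_scheduleD(11)[OF partial_schedule_run[OF feasible \<omega> order_refl] Start_machine[OF assms(1)] _ assms(3)]
    Start_machine[OF assms(2)] assms
  by (simp add: policy_completion_eq realization_def)

end


section \<open>Independence\<close>

text \<open>The product of two countable discrete spaces is discrete, so \<open>f\<close> may be any
  function whatsoever; this is what admits arbitrary policies. Independence makes the joint law a
  product, and Fubini lets \<open>Y\<close> run over a separate copy
  \<open>\<omega>'\<close>.\<close>

lemma (in prob_space) indep_var_count_space:
  fixes f :: "'b \<Rightarrow> 'b \<Rightarrow> ennreal"
  assumes XY: "indep_var (count_space A) X (count_space B) Y" and AB: "countable A" "countable B"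
  shows nn_integral_indep_var_count_space:
      "(\<integral>\<^sup>+\<omega>. f (X \<omega>) (Y \<omega>) \<partial>M) = (\<integral>\<^sup>+\<omega>. \<integral>\<^sup>+\<omega>'. f (X \<omega>) (Y \<omega>') \<partial>M \<partial>M)"
    and measurable_indep_var_count_space: "(\<lambda>\<omega>. f (X \<omega>) (Y \<omega>)) \<in> borel_measurable M"
proof -
  from XY have [measurable]: "X \<in> measurable M (count_space A)" "Y \<in> measurable M (count_space B)"
    and joint: "distr M (count_space A) X \<Otimes>\<^sub>M distr M (count_space B) Y =
      distr M (count_space A \<Otimes>\<^sub>M count_space B) (\<lambda>\<omega>. (X \<omega>, Y \<omega>))"
    by (simp_all add: indep_var_distribution_eq)
  interpret Y: prob_space "distr M (count_space B) Y"
    by (rule prob_space_distr) measurable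
  have f: "(\<lambda>(x, y). f x y) \<in> borel_measurable (count_space A \<Otimes>\<^sub>M count_space B)"
    by (simp add: pair_measure_countable[OF AB])
  have pair: "(\<lambda>\<omega>. (X \<omega>, Y \<omega>)) \<in> measurable M (count_space A \<Otimes>\<^sub>M count_space B)"
    by measurable
  from measurable_compose[OF pair f] show "(\<lambda>\<omega>. f (X \<omega>) (Y \<omega>)) \<in> borel_measurable M"
    by simp
  have "(\<integral>\<^sup>+\<omega>. f (X \<omega>) (Y \<omega>) \<partial>M) =
      (\<integral>\<^sup>+z. (\<lambda>(x, y). f x y) z \<partial>distr M (count_space A \<Otimes>\<^sub>M count_space B) (\<lambda>\<omega>. (X \<omega>, Y \<omega>)))"
    using f pair by (subst nn_integral_distr) simp_all
  also have "\<dots> = (\<integral>\<^sup>+x. \<integral>\<^sup>+y. f x y \<partial>distr M (count_space B) Y \<partial>distr M (count_space A) X)"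
    using f by (subst joint[symmetric], subst Y.nn_integral_fst[symmetric])
      (simp_all add: measurable_cong_sets[OF sets_pair_measure_cong[OF sets_distr sets_distr] refl])
  also have "\<dots> = (\<integral>\<^sup>+\<omega>. \<integral>\<^sup>+\<omega>'. f (X \<omega>) (Y \<omega>') \<partial>M \<partial>M)"
    by (simp add: nn_integral_distr)
  finally show "(\<integral>\<^sup>+\<omega>. f (X \<omega>) (Y \<omega>) \<partial>M) = (\<integral>\<^sup>+\<omega>. \<integral>\<^sup>+\<omega>'. f (X \<omega>) (Y \<omega>') \<partial>M \<partial>M)" .
qed

text \<open>Indexed by jobs first, since independence holds between the vectors of different jobs,
  while the entries of one vector may be dependent. Restricting the functions to finite index sets
  keeps the range countable.\<close>

definition columns :: "('a, 'm) sched_inst \<Rightarrow> nat set \<Rightarrow> 'a \<Rightarrow> nat \<Rightarrow> 'm \<Rightarrow> nat" where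
  "columns I A \<omega> = (\<lambda>j\<in>A. \<lambda>i\<in>machines I. ptime I i j \<omega>)"

text \<open>The processing times of j, and all entries outside the instance, are replaced by the
  dummy value 0. In a feasible run only jobs of the instance are running, on eligible machines, so
  the start of j is unaffected. It is thereby a function of the vectors of the other jobs.\<close>

lemma start_of_run_columns:
  assumes "feasible_policy I \<pi>" "\<omega> \<in> space (probs I)"
  shows "start_of j (run \<pi> (realization I \<omega>) (2 * njobs I)) =
    start_of j (run \<pi> (\<lambda>i k. if i \<in> machines I \<and> k \<in> jobs I - {j}
      then columns I (jobs I - {j}) \<omega> k i else 0) (2 * njobs I))"
proof (rule start_of_run_cong[THEN conjunct1])
  fix m s k i
  assume "m < 2 * njobs I" and r: "(s, k, i) \<in> running (run \<pi> (realization I \<omega>) m)" and "k \<noteq> j"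
  then have h: "partial_schedule I (realization I \<omega>) (run \<pi> (realization I \<omega>) m)"
    by (intro partial_schedule_run assms) simp
  from r have "Start s k i \<in> set (run \<pi> (realization I \<omega>) m)"
    by (simp add: running_def)
  from partial_scheduleD(3,4)[OF h this] \<open>k \<noteq> j\<close>
  show "realization I \<omega> i k = (if i \<in> machines I \<and> k \<in> jobs I - {j}
      then columns I (jobs I - {j}) \<omega> k i else 0)"
    by (simp add: realization_def columns_def eligible_def)
qed

lemma indep_var_columns:
  assumes "valid_inst I" "A \<inter> B = {}" "A \<subseteq> jobs I" "B \<subseteq> jobs I"
  shows "prob_space.indep_var (probs I)
    (count_space (\<Pi>\<^sub>E j\<in>A. \<Pi>\<^sub>E i\<in>machines I. UNIV)) (columns I A)
    (count_space (\<Pi>\<^sub>E j\<in>B. \<Pi>\<^sub>E i\<in>machines I. UNIV)) (columns I B)"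
proof -
  from assms(1) interpret prob_space "probs I"
    by (simp add: valid_inst_def)
  have fin: "finite (machines I)" "finite A" "finite B"
    using assms by (auto simp: valid_inst_def jobs_def intro: finite_subset)
  have M: "(\<Pi>\<^sub>M i\<in>machines I. count_space (UNIV :: nat set)) =
      count_space (\<Pi>\<^sub>E i\<in>machines I. UNIV)"
    by (rule count_space_PiM_finite) (use fin in auto)
  have PiM: "(\<Pi>\<^sub>M j\<in>C. \<Pi>\<^sub>M i\<in>machines I. count_space (UNIV :: nat set)) =
      count_space (\<Pi>\<^sub>E j\<in>C. \<Pi>\<^sub>E i\<in>machines I. UNIV)" if "finite C" for C :: "nat set"
    unfolding M using that fin(1) by (intro count_space_PiM_finite countable_PiE) auto
  have "indep_vars (\<lambda>j. \<Pi>\<^sub>M i\<in>machines I. count_space UNIV)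
      (\<lambda>j \<omega>. \<lambda>i\<in>machines I. ptime I i j \<omega>) (jobs I)"
    using assms(1) by (simp add: valid_inst_def)
  from indep_var_restrict[OF this assms(2-4)] show ?thesis
    unfolding PiM[OF fin(2)] PiM[OF fin(3)] columns_def .
qed

text \<open>Start and machine of j are functions of the vectors of the other jobs, hence independent
  of the whole vector of j. In expectation its processing times may therefore be redrawn (as
  \<open>\<omega>'\<close>), although the machine is random and the entries of the vector may be
  dependent.\<close>

lemma decoupling:
  fixes f :: "real \<Rightarrow> 'm \<Rightarrow> nat \<Rightarrow> ennreal" and I :: "('a, 'm) sched_inst"
  assumes I: "valid_inst I" and \<pi>: "feasible_policy I \<pi>" and j: "j \<in> jobs I"
  defines "F \<equiv> \<lambda>\<omega> \<omega>'. f (start_time I \<pi> j \<omega>) (machine I \<pi> j \<omega>) (ptime I (machine I \<pi> j \<omega>) j \<omega>')"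
  shows nn_integral_decoupling:
      "(\<integral>\<^sup>+\<omega>. F \<omega> \<omega> \<partial>probs I) = (\<integral>\<^sup>+\<omega>. \<integral>\<^sup>+\<omega>'. F \<omega> \<omega>' \<partial>probs I \<partial>probs I)"
    and measurable_decoupling: "(\<lambda>\<omega>. F \<omega> \<omega>) \<in> borel_measurable (probs I)"
proof -
  from I interpret prob_space "probs I"
    by (simp add: valid_inst_def)
  let ?A = "jobs I - {j}"
  define st where "st r = the (start_of j (run \<pi>
    (\<lambda>i k. if i \<in> machines I \<and> k \<in> ?A then r k i else 0) (2 * njobs I)))"
    for r :: "nat \<Rightarrow> 'm \<Rightarrow> nat"
  define g where "g r v = f (fst (st r)) (snd (st r)) (v j (snd (st r)))"
    for r v :: "nat \<Rightarrow> 'm \<Rightarrow> nat"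
  have g: "F \<omega> \<omega>' = g (columns I ?A \<omega>) (columns I {j} \<omega>')" if "\<omega> \<in> space (probs I)" for \<omega> \<omega>'
  proof -
    have "st (columns I ?A \<omega>) = (start_time I \<pi> j \<omega>, machine I \<pi> j \<omega>)"
      by (simp add: st_def start_time_def machine_def start_of_run_columns[OF \<pi> that, of j])
    moreover have "machine I \<pi> j \<omega> \<in> machines I"
      using machine_eligible[OF \<pi> that j] by (simp add: eligible_def)
    ultimately show ?thesis
      by (simp add: F_def g_def columns_def)
  qed
  have fin: "finite (machines I)" "finite (jobs I)"
    using I by (auto simp: valid_inst_def jobs_def)
  note indep = indep_var_columns[OF I, of ?A "{j}"]
  have A: "?A \<inter> {j} = {}" "?A \<subseteq> jobs I" "{j} \<subseteq> jobs I"
    using j by auto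
  have cnt: "countable (\<Pi>\<^sub>E j\<in>C. \<Pi>\<^sub>E i\<in>machines I. (UNIV :: nat set))" if "finite C" for C :: "nat set"
    using that fin(1) by (intro countable_PiE) auto
  note cs = indep_var_count_space[OF indep[OF A] cnt cnt, of g]
  have "(\<integral>\<^sup>+\<omega>. F \<omega> \<omega> \<partial>probs I) = (\<integral>\<^sup>+\<omega>. g (columns I ?A \<omega>) (columns I {j} \<omega>) \<partial>probs I)"
    by (intro nn_integral_cong g)
  also have "\<dots> = (\<integral>\<^sup>+\<omega>. \<integral>\<^sup>+\<omega>'. g (columns I ?A \<omega>) (columns I {j} \<omega>') \<partial>probs I \<partial>probs I)"
    by (rule cs) (use fin in auto)
  also have "\<dots> = (\<integral>\<^sup>+\<omega>. \<integral>\<^sup>+\<omega>'. F \<omega> \<omega>' \<partial>probs I \<partial>probs I)"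
    by (intro nn_integral_cong g[symmetric])
  finally show "(\<integral>\<^sup>+\<omega>. F \<omega> \<omega> \<partial>probs I) = (\<integral>\<^sup>+\<omega>. \<integral>\<^sup>+\<omega>'. F \<omega> \<omega>' \<partial>probs I \<partial>probs I)" .
  have "(\<lambda>\<omega>. g (columns I ?A \<omega>) (columns I {j} \<omega>)) \<in> borel_measurable (probs I)"
    by (rule cs) (use fin in auto)
  then show "(\<lambda>\<omega>. F \<omega> \<omega>) \<in> borel_measurable (probs I)"
    by (subst measurable_cong[OF g])
qed


section \<open>The greedy assignment\<close>

lemma H_subset: "H I j i \<subseteq> jobs I"
  by (auto simp: H_def)

lemma H_jobs: "k \<in> H I j i \<Longrightarrow> k \<in> jobs I"
  using H_subset by (rule subsetD)

lemma finite_jobs [simp]: "finite (jobs I)"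
  by (simp add: jobs_def)

lemma finite_H [simp]: "finite (H I j i)"
  by (rule finite_subset[OF H_subset finite_jobs])

lemma H_refl: "j \<in> jobs I \<Longrightarrow> j \<in> H I j i"
  by (simp add: H_def)

lemma H_trans: "k \<in> H I j i \<Longrightarrow> j \<in> H I l i \<Longrightarrow> k \<in> H I l i"
  unfolding H_def by auto

text \<open>With \<open>H_refl\<close> and \<open>H_trans\<close> this makes
  \<open>k \<in> H I j i\<close> a total order on the jobs: Smith's order on machine i, with ties
  broken by index.\<close>

lemma not_in_H_iff:
  assumes "j \<in> jobs I" "k \<in> jobs I" "j \<noteq> k"
  shows "k \<notin> H I j i \<longleftrightarrow> j \<in> H I k i"
proof -
  have "\<not> (x < y \<or> k \<le> j \<and> y = x) \<longleftrightarrow> y < x \<or> j \<le> k \<and> x = y" for x y :: ennreal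
    using assms(3) by (cases x y rule: linorder_cases) auto
  from this[of "ratio I i j" "ratio I i k"] assms(1,2) show ?thesis
    by (simp add: H_def)
qed

lemma ennreal_cross_le:
  fixes x y p q :: ennreal
  assumes "x / p \<le> y / q" "0 < p" "p < top" "0 < q" "q < top"
  shows "x * q \<le> y * p"
proof -
  have cancel: "x / p * p = x" "y / q * q = y"
    using assms by (simp_all add: ennreal_divide_times)
  have "x * q = x / p * (p * q)"
    by (simp add: mult.assoc[symmetric] cancel)
  also have "\<dots> \<le> y / q * (p * q)"
    using assms(1) by (rule mult_right_mono) simp
  also have "\<dots> = y / q * q * p"
    by (simp only: mult_ac)
  finally show ?thesis
    by (simp add: cancel)
qed

section \<open>Increases, deterministic end times and backlog of the greedy assignment\<close>

locale greedy =
  fixes I :: "('a, 'm) sched_inst" and a :: "nat \<Rightarrow> 'm"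
  assumes valid: "valid_inst I" and greedy: "greedy_assignment I a"
begin

sublocale prob_space "probs I"
  using valid by (simp add: valid_inst_def)

definition w :: "nat \<Rightarrow> ennreal" where
  "w j = ennreal (weight I j)"

definition end_time :: "nat \<Rightarrow> ennreal" where
  "end_time k = (\<Sum>l | l \<in> H I k (a k) \<and> a l = a k. mean I (a k) l)"

definition backlog :: "'m \<Rightarrow> ennreal \<Rightarrow> ennreal" where
  "backlog i s = (\<Sum>k | k \<in> jobs I \<and> a k = i \<and> s < end_time k. w k)"

lemma mean_pos: "j \<in> jobs I \<Longrightarrow> i \<in> eligible I j \<Longrightarrow> 0 < mean I i j"
  and mean_finite: "i \<in> eligible I j \<Longrightarrow> mean I i j < top"
  and weight_nonneg: "j \<in> jobs I \<Longrightarrow> 0 \<le> weight I j"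
  and measurable_ptime: "j \<in> jobs I \<Longrightarrow> i \<in> eligible I j \<Longrightarrow>
    ptime I i j \<in> measurable (probs I) (count_space UNIV)"
  using valid by (auto simp: valid_inst_def eligible_def)

lemma assigned_eligible: "j \<in> jobs I \<Longrightarrow> a j \<in> eligible I j"
  and incr_assigned_le: "j \<in> jobs I \<Longrightarrow> i \<in> eligible I j \<Longrightarrow> incr I a j (a j) \<le> incr I a j i"
  using greedy by (auto simp: greedy_assignment_def is_arg_min_def not_less)

text \<open>Smith's exchange inequality: of the two possible delays of a pair, weight of one times
  mean of the other, the priority order incurs the smaller. It resolves the minima in the proof of
  \<open>incr_le\<close>.\<close>

lemma H_cross:
  assumes "k \<in> H I j i" "j \<in> jobs I" "i \<in> eligible I j" "i \<in> eligible I k"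
  shows "w j * mean I i k \<le> w k * mean I i j"
proof (rule ennreal_cross_le)
  show "w j / mean I i j \<le> w k / mean I i k"
    using assms(1) by (auto simp: H_def ratio_def w_def)
  from assms(1) have "k \<in> jobs I" by (rule H_jobs)
  with assms show "0 < mean I i j" "0 < mean I i k" "mean I i j < top" "mean I i k < top"
    by (auto intro: mean_pos mean_finite)
qed

lemma end_time_finite: "k \<in> jobs I \<Longrightarrow> end_time k < top"
  unfolding end_time_def by (auto intro!: mean_finite dest!: H_jobs assigned_eligible)

text \<open>A nonempty \<open>K\<close> has a last job \<open>l\<close> in the order of machine i.
  All of \<open>K\<close> is processed up to the end of \<open>l\<close>, which is at most
  \<open>s\<close>.\<close>

lemma sum_mean_le_end_time:
  assumes K: "K \<subseteq> {k \<in> jobs I. a k = i}" and s: "\<And>k. k \<in> K \<Longrightarrow> end_time k \<le> s"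
  shows "(\<Sum>k\<in>K. mean I i k) \<le> s"
proof (cases "K = {}")
  case False
  have fin: "finite K"
    using K by (rule finite_subset) simp
  from fin False K have "\<exists>l\<in>K. K \<subseteq> H I l i"
  proof (induction K rule: finite_ne_induct)
    case (singleton x)
    then show ?case using H_refl by auto
  next
    case (insert x K)
    then obtain l where l: "l \<in> K" "K \<subseteq> H I l i" by auto
    show ?case
    proof (cases "x \<in> H I l i")
      case True
      with l show ?thesis by auto
    next
      case x: False
      from l insert.hyps insert.prems have "x \<in> jobs I" "l \<in> jobs I" "l \<noteq> x" by auto
      with x have "l \<in> H I x i" using not_in_H_iff[of l I x i] by simp
      with l have "K \<subseteq> H I x i" using H_trans[of _ I l i x] by blast
      with \<open>x \<in> jobs I\<close> show ?thesis using H_refl by auto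
    qed
  qed
  then obtain l where l: "l \<in> K" "K \<subseteq> H I l i" by blast
  with K have "a l = i" by auto
  then have "end_time l = (\<Sum>k | k \<in> H I l i \<and> a k = i. mean I i k)"
    by (simp add: end_time_def)
  with K l(2) have "(\<Sum>k\<in>K. mean I i k) \<le> end_time l"
    by (auto intro!: sum_mono2)
  with s[OF l(1)] show ?thesis by simp
qed simp

text \<open>An earlier job \<open>k\<close> on machine \<open>i\<close> contributes \<open>min (w\<^sub>j E[P\<^sub>i\<^sub>k]) (w\<^sub>k E[P\<^sub>i\<^sub>j])\<close>
  to the increase. The first bound is used for the jobs that end by time \<open>s\<close>, the second one for
  the others.\<close>

lemma incr_le:
  assumes j: "j \<in> jobs I" and i: "i \<in> eligible I j"
  shows "incr I a j i \<le> w j * mean I i j + w j * s + mean I i j * backlog i s"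
proof -
  let ?K = "{k \<in> jobs I. a k = i}"
  let ?A = "{k \<in> H I j i. k < j \<and> a k = i}" and ?B = "{k \<in> L I j i. k < j \<and> a k = i}"
  define c where "c k = min (w j * mean I i k) (w k * mean I i j)" for k
  have K: "i \<in> eligible I k" if "k \<in> ?K" for k
    using that assigned_eligible by auto
  have AK: "?A \<subseteq> ?K" and BK: "?B \<subseteq> ?K" and AB: "?A \<inter> ?B = {}"
    by (auto simp: L_def dest: H_jobs)
  have fin: "finite ?A" "finite ?B" "finite ?K"
    using finite_subset[OF BK] by auto
  have "w j * mean I i k = c k" if "k \<in> ?A" for k
    using H_cross[of k j i] that AK K j i by (auto simp: c_def)
  then have A: "w j * (\<Sum>k\<in>?A. mean I i k) = (\<Sum>k\<in>?A. c k)"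
    by (simp add: sum_distrib_left)
  have "w k * mean I i j = c k" if "k \<in> ?B" for k
  proof -
    from that have "k \<in> jobs I" "k < j" "j \<in> H I k i"
      using not_in_H_iff[of j I k i] j by (auto simp: L_def)
    with H_cross[of j k i] K[of k] that i show ?thesis
      by (auto simp: c_def min_absorb2)
  qed
  then have B: "mean I i j * (\<Sum>k\<in>?B. w k) = (\<Sum>k\<in>?B. c k)"
    by (simp add: sum_distrib_left mult.commute)
  have "{k. k \<in> H I j i \<and> k \<le> j \<and> (k = j \<or> a k = i)} = insert j ?A"
    using H_refl[OF j, of i] by auto
  then have "incr I a j i = w j * (mean I i j + (\<Sum>k\<in>?A. mean I i k)) + mean I i j * (\<Sum>k\<in>?B. w k)"
    using fin by (simp add: incr_def w_def conj_ac)
  also have "\<dots> = w j * mean I i j + (\<Sum>k\<in>?A \<union> ?B. c k)"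
    using AB fin by (simp add: distrib_left A B sum.union_disjoint add.assoc)
  \<comment> \<open>Adding the jobs presented after j, and j itself if \<open>a j = i\<close>,
    replaces the state at the presentation of j by the final assignment, to which
    \<open>end_time\<close> refers.\<close>
  also have "(\<Sum>k\<in>?A \<union> ?B. c k) \<le> (\<Sum>k\<in>?K. c k)"
    using AK BK by (intro sum_mono2 fin) auto
  also have "\<dots> = (\<Sum>k\<in>{k \<in> ?K. end_time k \<le> s} \<union> {k \<in> ?K. s < end_time k}. c k)"
    by (intro sum.cong) auto
  also have "\<dots> = (\<Sum>k | k \<in> ?K \<and> end_time k \<le> s. c k) + (\<Sum>k | k \<in> ?K \<and> s < end_time k. c k)"
    by (intro sum.union_disjoint) auto
  also have "(\<Sum>k | k \<in> ?K \<and> end_time k \<le> s. c k) \<le> (\<Sum>k | k \<in> ?K \<and> end_time k \<le> s. w j * mean I i k)"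
    by (intro sum_mono) (simp add: c_def)
  also have "\<dots> \<le> w j * s"
    unfolding sum_distrib_left[symmetric]
    by (intro mult_left_mono sum_mean_le_end_time) auto
  also have "(\<Sum>k | k \<in> ?K \<and> s < end_time k. c k) \<le> (\<Sum>k | k \<in> ?K \<and> s < end_time k. w k * mean I i j)"
    by (intro sum_mono) (simp add: c_def)
  also have "\<dots> = mean I i j * backlog i s"
    by (simp add: backlog_def sum_distrib_left mult.commute conj_assoc)
  finally show ?thesis
    by (simp add: add.assoc add_mono)
qed

text \<open>Double counting over pairs of jobs on one machine. The delay that k causes j is booked
  under j on the left, but under whichever of the two is presented later on the right;
  \<open>?B\<close> collects the pairs whose booking changes.\<close>

lemma sum_end_time_eq_sum_incr: "(\<Sum>j\<in>jobs I. w j * end_time j) = (\<Sum>j\<in>jobs I. incr I a j (a j))"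
proof -
  let ?m = "\<lambda>k. mean I (a k) k"
  let ?A = "\<lambda>j. {k. k \<in> H I j (a j) \<and> k \<le> j \<and> (k = j \<or> a k = a j)}"
  let ?B = "\<lambda>j. {k. k \<in> H I j (a j) \<and> j < k \<and> a k = a j}"
  let ?C = "\<lambda>j. {k. k \<in> L I j (a j) \<and> k < j \<and> a k = a j}"
  have "(\<Sum>j\<in>jobs I. w j * end_time j) =
      (\<Sum>j\<in>jobs I. w j * (\<Sum>k\<in>?A j. mean I (a j) k) + w j * (\<Sum>k\<in>?B j. mean I (a j) k))"
  proof (intro sum.cong refl)
    fix j
    have "end_time j = (\<Sum>k\<in>?A j \<union> ?B j. mean I (a j) k)"
      unfolding end_time_def by (intro sum.cong) auto
    also have "\<dots> = (\<Sum>k\<in>?A j. mean I (a j) k) + (\<Sum>k\<in>?B j. mean I (a j) k)"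
      by (intro sum.union_disjoint) auto
    finally show "w j * end_time j =
        w j * (\<Sum>k\<in>?A j. mean I (a j) k) + w j * (\<Sum>k\<in>?B j. mean I (a j) k)"
      by (simp add: distrib_left)
  qed
  also have "\<dots> = (\<Sum>j\<in>jobs I. w j * (\<Sum>k\<in>?A j. mean I (a j) k)) +
      (\<Sum>j\<in>jobs I. \<Sum>k\<in>?B j. w j * mean I (a j) k)"
    by (simp add: sum.distrib sum_distrib_left)
  also have "(\<Sum>j\<in>jobs I. \<Sum>k\<in>?B j. w j * mean I (a j) k) =
      (\<Sum>j\<in>jobs I. \<Sum>k | k \<in> jobs I \<and> k \<in> ?B j. w j * ?m k)"
    by (intro sum.cong refl arg_cong2[where f = sum]) (auto dest: H_jobs)
  also have "\<dots> = (\<Sum>k\<in>jobs I. \<Sum>j | j \<in> jobs I \<and> k \<in> ?B j. w j * ?m k)"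
    by (rule sum.swap_restrict) auto
  also have "\<dots> = (\<Sum>k\<in>jobs I. \<Sum>j\<in>?C k. w j * ?m k)"
  proof (intro sum.cong refl)
    fix k assume k: "k \<in> jobs I"
    show "{j \<in> jobs I. k \<in> ?B j} = ?C k"
    proof (intro set_eqI)
      fix j
      show "j \<in> {j \<in> jobs I. k \<in> ?B j} \<longleftrightarrow> j \<in> ?C k"
        using not_in_H_iff[OF k, of j "a k"] by (auto simp: L_def)
    qed
  qed
  also have "\<dots> = (\<Sum>k\<in>jobs I. ?m k * (\<Sum>j\<in>?C k. w j))"
    by (simp add: sum_distrib_left mult.commute)
  finally show ?thesis
    by (simp add: incr_def w_def sum.distrib)
qed

lemma ALG_eq: "ALG I a = (\<Sum>j\<in>jobs I. w j * end_time j)"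
proof -
  have meas: "(\<lambda>\<omega>. of_nat (ptime I (a j) k \<omega>) :: ennreal) \<in> borel_measurable (probs I)"
    if "k \<in> H I j (a j) \<and> a k = a j" for j k
  proof -
    from that have "ptime I (a j) k \<in> measurable (probs I) (count_space UNIV)"
      using H_jobs[of k I j "a j"] assigned_eligible[of k] by (auto intro: measurable_ptime)
    then show ?thesis
      by (rule measurable_compose) simp
  qed
  define S where "S j = {k. k \<in> H I j (a j) \<and> a k = a j}" for j
  have greedy_completion: "ennreal (greedy_completion I a \<omega> j) = (\<Sum>k\<in>S j. of_nat (ptime I (a j) k \<omega>))"
    for \<omega> j
    unfolding greedy_completion_def S_def by (simp add: ennreal_of_nat_eq_real_of_nat)
  have "ALG I a = (\<integral>\<^sup>+\<omega>. (\<Sum>j\<in>jobs I. w j * ennreal (greedy_completion I a \<omega> j)) \<partial>probs I)"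
    unfolding ALG_def
  proof (rule nn_integral_cong)
    fix \<omega>
    have nn: "0 \<le> greedy_completion I a \<omega> j" for j
      unfolding greedy_completion_def by (rule sum_nonneg) simp
    then have "ennreal (\<Sum>j\<in>jobs I. weight I j * greedy_completion I a \<omega> j) =
        (\<Sum>j\<in>jobs I. ennreal (weight I j * greedy_completion I a \<omega> j))"
      by (intro sum_ennreal[symmetric] mult_nonneg_nonneg weight_nonneg)
    also have "\<dots> = (\<Sum>j\<in>jobs I. w j * ennreal (greedy_completion I a \<omega> j))"
      unfolding w_def using nn by (intro sum.cong refl ennreal_mult weight_nonneg)
    finally show "ennreal (\<Sum>j\<in>jobs I. weight I j * greedy_completion I a \<omega> j) =
        (\<Sum>j\<in>jobs I. w j * ennreal (greedy_completion I a \<omega> j))" .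
  qed
  also have "\<dots> = (\<Sum>j\<in>jobs I. w j * (\<Sum>k\<in>S j. \<integral>\<^sup>+\<omega>. of_nat (ptime I (a j) k \<omega>) \<partial>probs I))"
  proof -
    have "(\<integral>\<^sup>+\<omega>. (\<Sum>k\<in>S j. of_nat (ptime I (a j) k \<omega>)) \<partial>probs I) =
        (\<Sum>k\<in>S j. \<integral>\<^sup>+\<omega>. of_nat (ptime I (a j) k \<omega>) \<partial>probs I)" for j
      by (rule nn_integral_sum) (simp add: meas S_def)
    moreover have "(\<lambda>\<omega>. \<Sum>k\<in>S j. of_nat (ptime I (a j) k \<omega>) :: ennreal) \<in> borel_measurable (probs I)" for j
      by (rule borel_measurable_sum) (simp add: meas S_def)
    ultimately show ?thesis
      by (simp add: greedy_completion nn_integral_sum nn_integral_cmult)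
  qed
  also have "\<dots> = (\<Sum>j\<in>jobs I. w j * end_time j)"
    by (simp add: end_time_def mean_def S_def)
  finally show ?thesis .
qed

end


section \<open>Comparison with an arbitrary policy\<close>

context greedy
begin

section \<open>Integration over the periods of a policy\<close>

lemma backlog_eq: "backlog i s = (\<Sum>k | k \<in> jobs I \<and> a k = i. w k * indicator {..<end_time k} s)"
  by (simp add: backlog_def indicator_def if_distrib cong: if_cong) (rule sum.cong, auto)

lemma measurable_backlog [measurable]: "backlog i \<in> borel_measurable borel"
  unfolding backlog_eq by measurable

lemma sum_backlog: "(\<Sum>i\<in>machines I. backlog i s) = (\<Sum>k\<in>jobs I. w k * indicator {..<end_time k} s)"
proof -
  have "(\<Sum>i\<in>machines I. backlog i s) =
      (\<Sum>i\<in>machines I. \<Sum>k | k \<in> {k \<in> jobs I. s < end_time k} \<and> a k = i. w k)"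
    by (simp add: backlog_def conj_ac)
  also have "\<dots> = (\<Sum>k | k \<in> jobs I \<and> s < end_time k. w k)"
    using valid assigned_eligible by (intro sum.group) (auto simp: valid_inst_def eligible_def)
  also have "\<dots> = (\<Sum>k\<in>jobs I. w k * indicator {..<end_time k} s)"
    by (simp add: indicator_def if_distrib cong: if_cong) (rule sum.cong, auto)
  finally show ?thesis .
qed

text \<open>Integrating \<open>incr_le\<close> at time \<open>2 s\<close> over the period in which a policy processes \<open>j\<close>.
  The factor 2 is what lets the backlog, summed over all jobs, be absorbed by the left-hand side.\<close>

lemma incr_period_le:
  assumes j: "j \<in> jobs I" and i: "i \<in> eligible I j" and "0 \<le> t" "0 \<le> p"
  shows "incr I a j (a j) * (ennreal p / mean I i j) \<le>
    w j * (ennreal p + ennreal (2 * t * p + p\<^sup>2) / mean I i j) +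
    (\<integral>\<^sup>+s. backlog i (ennreal (2 * s)) * indicator {t..<t + p} s \<partial>lborel)"
    (is "_ \<le> _ + ?B")
proof -
  let ?m = "mean I i j" and ?\<alpha> = "incr I a j (a j)"
  have m: "?m \<noteq> 0" "?m < top"
    using mean_pos[OF j i] mean_finite[OF i] by auto
  \<comment> \<open>The half-open period is closed so that the fundamental theorem of calculus
    applies, with antiderivative the square of s.\<close>
  have "(\<integral>\<^sup>+s. ennreal (2 * s) * indicator {t..<t + p} s \<partial>lborel) \<le>
      (\<integral>\<^sup>+s. ennreal (2 * s) * indicator {t..t + p} s \<partial>lborel)"
    by (intro nn_integral_mono) (auto simp: indicator_def)
  also have "\<dots> = ennreal ((t + p)\<^sup>2 - t\<^sup>2)"
    using assms(3,4) by (intro nn_integral_FTC_Icc) (auto intro!: derivative_eq_intros)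
  also have "(t + p)\<^sup>2 - t\<^sup>2 = 2 * t * p + p\<^sup>2"
    by (simp add: power2_eq_square algebra_simps)
  finally have double: "(\<integral>\<^sup>+s. ennreal (2 * s) * indicator {t..<t + p} s \<partial>lborel) \<le> ennreal (2 * t * p + p\<^sup>2)" .
  have len: "(\<integral>\<^sup>+s. indicator {t..<t + p} s \<partial>lborel) = ennreal p"
    using assms(4) by simp
  have "?\<alpha> * ennreal p = (\<integral>\<^sup>+s. ?\<alpha> * indicator {t..<t + p} s \<partial>lborel)"
    by (subst nn_integral_cmult) (simp_all only: len, measurable)
  also have "\<dots> \<le> (\<integral>\<^sup>+s. w j * ?m * indicator {t..<t + p} s +
      (w j * (ennreal (2 * s) * indicator {t..<t + p} s) +
       ?m * (backlog i (ennreal (2 * s)) * indicator {t..<t + p} s)) \<partial>lborel)"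
  proof (rule nn_integral_mono)
    fix s
    show "?\<alpha> * indicator {t..<t + p} s \<le> w j * ?m * indicator {t..<t + p} s +
      (w j * (ennreal (2 * s) * indicator {t..<t + p} s) +
       ?m * (backlog i (ennreal (2 * s)) * indicator {t..<t + p} s))"
      using order_trans[OF incr_assigned_le[OF j i] incr_le[OF j i, of "ennreal (2 * s)"]]
      by (auto simp: indicator_def add.assoc)
  qed
  also have "\<dots> = w j * ?m * ennreal p +
      (w j * (\<integral>\<^sup>+s. ennreal (2 * s) * indicator {t..<t + p} s \<partial>lborel) + ?m * ?B)"
    by (simp add: nn_integral_add nn_integral_cmult len[simplified])
  also have "\<dots> \<le> w j * ?m * ennreal p + (w j * ennreal (2 * t * p + p\<^sup>2) + ?m * ?B)"
    by (intro add_mono mult_left_mono double) auto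
  finally have "?\<alpha> * ennreal p / ?m \<le> (w j * ?m * ennreal p + (w j * ennreal (2 * t * p + p\<^sup>2) + ?m * ?B)) / ?m"
    by (rule divide_right_mono_ennreal)
  also have "\<dots> = w j * ?m * ennreal p / ?m + (w j * ennreal (2 * t * p + p\<^sup>2) / ?m + ?m * ?B / ?m)"
    by (simp only: add_divide_distrib_ennreal)
  also have "w j * ?m * ennreal p / ?m = w j * ennreal p"
    using m by (subst mult.assoc, subst mult.commute[of ?m], subst mult.assoc[symmetric])
      (simp add: mult_divide_eq_ennreal)
  also have "?m * ?B / ?m = ?B"
    using m by (subst mult.commute) (simp add: mult_divide_eq_ennreal)
  finally show ?thesis
    by (simp add: ennreal_times_divide distrib_left add.assoc)
qed

text \<open>Job k counts at time 2 s for 0 \<le> s < end_time k / 2, whence the half. The cut to s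
  \<ge> 0 matters: \<open>ennreal\<close> sends negative numbers to 0, so the backlog would
  otherwise stay constant on the whole negative half-line.\<close>

lemma nn_integral_backlog:
  "(\<integral>\<^sup>+s. (\<Sum>i\<in>machines I. backlog i (ennreal (2 * s))) * indicator {0..} s \<partial>lborel) = ALG I a / 2"
proof -
  have len: "(\<integral>\<^sup>+s. indicator {..<end_time k} (ennreal (2 * s)) * indicator {0..} s \<partial>lborel) = end_time k / 2"
    if k: "k \<in> jobs I" for k
  proof -
    obtain d where d: "end_time k = ennreal d" "0 \<le> d"
      using end_time_finite[OF k] by (cases "end_time k") auto
    have "(\<integral>\<^sup>+s. indicator {..<end_time k} (ennreal (2 * s)) * indicator {0..} s \<partial>lborel) =
        (\<integral>\<^sup>+s. indicator {0..<d / 2} s \<partial>lborel)"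
      unfolding d(1) by (intro nn_integral_cong) (auto simp: indicator_def ennreal_less_iff)
    also have "\<dots> = ennreal (d / 2)"
      using d(2) by simp
    finally show ?thesis
      using d by (simp add: ennreal_divide_numeral)
  qed
  have "(\<integral>\<^sup>+s. (\<Sum>i\<in>machines I. backlog i (ennreal (2 * s))) * indicator {0..} s \<partial>lborel) =
      (\<integral>\<^sup>+s. (\<Sum>k\<in>jobs I. w k * (indicator {..<end_time k} (ennreal (2 * s)) * indicator {0..} s)) \<partial>lborel)"
    unfolding sum_backlog sum_distrib_right mult.assoc ..
  also have "\<dots> = (\<Sum>k\<in>jobs I. w k * (end_time k / 2))"
    by (subst nn_integral_sum) (simp_all add: nn_integral_cmult len)
  also have "\<dots> = ALG I a / 2"
    by (simp add: ALG_eq divide_ennreal_def sum_distrib_right mult.assoc)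
  finally show ?thesis .
qed

lemma second_moment_le:
  assumes j: "j \<in> jobs I" and i: "i \<in> eligible I j"
  shows "(\<integral>\<^sup>+\<omega>. ennreal ((real (ptime I i j \<omega>))\<^sup>2) \<partial>probs I) / mean I i j \<le> (1 + Delta I) * mean I i j"
proof -
  let ?P = "\<lambda>\<omega>. real (ptime I i j \<omega>)" and ?m = "mean I i j"
  define r where "r = enn2real ?m"
  have m: "?m = ennreal r" "0 < r"
    using mean_pos[OF j i] mean_finite[OF i] by (auto simp: r_def enn2real_positive_iff)
  have [measurable]: "?P \<in> borel_measurable (probs I)"
    using measurable_ptime[OF j i] by (rule measurable_compose) simp
  have mP: "(\<integral>\<^sup>+\<omega>. ennreal (?P \<omega>) \<partial>probs I) = ennreal r"
    using m(1) by (simp add: mean_def ennreal_of_nat_eq_real_of_nat)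
  \<comment> \<open>The second moment is variance plus squared mean. Writing it as P^2 + r^2 = (P -
    r)^2 + 2 r P keeps all terms nonnegative, so the integrals split even if the variance is
    infinite; only the finite r^2 is cancelled.\<close>
  have "(\<integral>\<^sup>+\<omega>. ennreal ((?P \<omega>)\<^sup>2) \<partial>probs I) + ennreal (r\<^sup>2) =
      (\<integral>\<^sup>+\<omega>. ennreal ((?P \<omega>)\<^sup>2) + ennreal (r\<^sup>2) \<partial>probs I)"
    by (subst nn_integral_add) (simp_all add: emeasure_space_1)
  also have "\<dots> = (\<integral>\<^sup>+\<omega>. ennreal ((?P \<omega> - r)\<^sup>2) + ennreal (2 * r) * ennreal (?P \<omega>) \<partial>probs I)"
  proof (rule nn_integral_cong)
    fix \<omega>
    have "ennreal ((?P \<omega>)\<^sup>2) + ennreal (r\<^sup>2) = ennreal ((?P \<omega> - r)\<^sup>2 + 2 * r * ?P \<omega>)"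
      by (subst ennreal_plus[symmetric]) (simp_all add: power2_eq_square algebra_simps)
    also have "\<dots> = ennreal ((?P \<omega> - r)\<^sup>2) + ennreal (2 * r) * ennreal (?P \<omega>)"
      using m(2) by (simp add: ennreal_mult)
    finally show "ennreal ((?P \<omega>)\<^sup>2) + ennreal (r\<^sup>2) =
        ennreal ((?P \<omega> - r)\<^sup>2) + ennreal (2 * r) * ennreal (?P \<omega>)" .
  qed
  also have "\<dots> = var I i j + ennreal (2 * r) * ennreal r"
    by (subst nn_integral_add) (simp_all add: var_def r_def[symmetric] nn_integral_cmult mP)
  also have "ennreal (2 * r) * ennreal r = ennreal (r\<^sup>2) + ennreal (r\<^sup>2)"
    using m(2) by (simp add: ennreal_plus[symmetric] ennreal_mult[symmetric] power2_eq_square del: ennreal_plus)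
  finally have "ennreal (r\<^sup>2) + (\<integral>\<^sup>+\<omega>. ennreal ((?P \<omega>)\<^sup>2) \<partial>probs I) = ennreal (r\<^sup>2) + (var I i j + ?m\<^sup>2)"
    using m by (simp add: ac_simps ennreal_power)
  then have eq: "(\<integral>\<^sup>+\<omega>. ennreal ((?P \<omega>)\<^sup>2) \<partial>probs I) = var I i j + ?m\<^sup>2"
    by (simp add: ennreal_add_left_cancel)
  have "var I i j / ?m\<^sup>2 \<le> Delta I"
    unfolding Delta_def using j i by (intro SUP_upper2[of "(i, j)"]) auto
  then have "var I i j / ?m\<^sup>2 * ?m \<le> Delta I * ?m"
    by (rule mult_right_mono) simp
  moreover have "var I i j / ?m = var I i j / ?m\<^sup>2 * ?m"
  proof -
    have "?m / ?m\<^sup>2 = 1 / ?m"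
      using m by (simp add: power2_eq_square ennreal_mult[symmetric] divide_ennreal flip: ennreal_1)
    then show ?thesis
      by (simp add: ennreal_divide_times ennreal_times_divide)
  qed
  moreover have "?m\<^sup>2 / ?m = ?m"
    using m by (simp add: power2_eq_square mult_divide_eq_ennreal)
  ultimately show ?thesis
    by (simp add: eq add_divide_distrib_ennreal distrib_right add.commute add_left_mono)
qed

text \<open>At any time s a machine processes at most one job, so the jobs in process sit on
  different machines and no backlog is counted twice. Half-open periods guarantee this also at the
  instant when one job replaces another.\<close>

lemma sum_backlog_periods_le:
  assumes \<pi>: "feasible_policy I \<pi>" and \<omega>: "\<omega> \<in> space (probs I)"
  shows "(\<Sum>j\<in>jobs I. backlog (machine I \<pi> j \<omega>) u *
      indicator {start_time I \<pi> j \<omega>..<policy_completion I \<pi> \<omega> j} s) \<le>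
    (\<Sum>i\<in>machines I. backlog i u) * indicator {0..} s"
proof -
  let ?I = "\<lambda>j. {start_time I \<pi> j \<omega>..<policy_completion I \<pi> \<omega> j}"
  let ?T = "{j \<in> jobs I. s \<in> ?I j}" and ?\<mu> = "\<lambda>j. machine I \<pi> j \<omega>"
  have "(\<Sum>j\<in>jobs I. backlog (?\<mu> j) u * indicator (?I j) s) = (\<Sum>j\<in>?T. backlog (?\<mu> j) u)"
    by (simp add: indicator_def if_distrib cong: if_cong) (rule sum.cong, auto)
  also have "\<dots> \<le> (\<Sum>i\<in>machines I. backlog i u) * indicator {0..} s"
  proof (cases "0 \<le> s")
    case True
    have "inj_on ?\<mu> ?T"
    proof (rule inj_onI, rule ccontr)
      fix j k assume jk: "j \<in> ?T" "k \<in> ?T" "?\<mu> j = ?\<mu> k" "j \<noteq> k"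
      then have "policy_completion I \<pi> \<omega> j \<le> start_time I \<pi> k \<omega> \<or>
          policy_completion I \<pi> \<omega> k \<le> start_time I \<pi> j \<omega>"
        by (intro machine_disjoint[OF \<pi> \<omega>]) auto
      with jk show False by auto
    qed
    then have "(\<Sum>j\<in>?T. backlog (?\<mu> j) u) = (\<Sum>i\<in>?\<mu> ` ?T. backlog i u)"
      by (simp add: sum.reindex)
    also have "\<dots> \<le> (\<Sum>i\<in>machines I. backlog i u)"
      using valid machine_eligible[OF \<pi> \<omega>]
      by (intro sum_mono2) (auto simp: valid_inst_def eligible_def)
    finally show ?thesis
      using True by simp
  next
    case False
    then have "?T = {}"
      using start_time_nonneg[OF \<pi> \<omega>] by force
    then show ?thesis
      by (simp only: sum.empty) simp
  qed
  finally show ?thesis .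
qed

text \<open>An inequality for each single outcome. Non-anticipation enters only afterwards, when
  expectations are taken.\<close>

lemma sum_incr_le:
  assumes \<pi>: "feasible_policy I \<pi>" and \<omega>: "\<omega> \<in> space (probs I)"
  defines "t \<equiv> \<lambda>j. start_time I \<pi> j \<omega>" and "\<mu> \<equiv> \<lambda>j. machine I \<pi> j \<omega>"
  defines "p \<equiv> \<lambda>j. real (ptime I (\<mu> j) j \<omega>)"
  shows "(\<Sum>j\<in>jobs I. incr I a j (a j) * (ennreal (p j) / mean I (\<mu> j) j)) \<le>
    (\<Sum>j\<in>jobs I. w j * (ennreal (p j) + ennreal (2 * t j * p j + (p j)\<^sup>2) / mean I (\<mu> j) j)) +
    ALG I a / 2"
proof -
  let ?B = "\<lambda>j s. backlog (\<mu> j) (ennreal (2 * s)) * indicator {t j..<t j + p j} s"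
  have "(\<Sum>j\<in>jobs I. incr I a j (a j) * (ennreal (p j) / mean I (\<mu> j) j)) \<le>
    (\<Sum>j\<in>jobs I. w j * (ennreal (p j) + ennreal (2 * t j * p j + (p j)\<^sup>2) / mean I (\<mu> j) j) +
      (\<integral>\<^sup>+s. ?B j s \<partial>lborel))"
    using machine_eligible[OF \<pi> \<omega>] start_time_nonneg[OF \<pi> \<omega>]
    by (intro sum_mono incr_period_le) (auto simp: t_def \<mu>_def p_def)
  also have "\<dots> = (\<Sum>j\<in>jobs I. w j * (ennreal (p j) + ennreal (2 * t j * p j + (p j)\<^sup>2) / mean I (\<mu> j) j)) +
      (\<integral>\<^sup>+s. (\<Sum>j\<in>jobs I. ?B j s) \<partial>lborel)"
    by (subst nn_integral_sum) (simp_all add: sum.distrib)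
  also have "(\<integral>\<^sup>+s. (\<Sum>j\<in>jobs I. ?B j s) \<partial>lborel) \<le>
      (\<integral>\<^sup>+s. (\<Sum>i\<in>machines I. backlog i (ennreal (2 * s))) * indicator {0..} s \<partial>lborel)"
  proof (rule nn_integral_mono)
    fix s
    have "(\<Sum>j\<in>jobs I. ?B j s) = (\<Sum>j\<in>jobs I. backlog (machine I \<pi> j \<omega>) (ennreal (2 * s)) *
        indicator {start_time I \<pi> j \<omega>..<policy_completion I \<pi> \<omega> j} s)"
      by (intro sum.cong refl) (simp add: policy_completion_eq[OF \<pi> \<omega>] t_def \<mu>_def p_def)
    then show "(\<Sum>j\<in>jobs I. ?B j s) \<le>
        (\<Sum>i\<in>machines I. backlog i (ennreal (2 * s))) * indicator {0..} s"
      using sum_backlog_periods_le[OF \<pi> \<omega>] by simp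
  qed
  finally show ?thesis
    by (simp add: nn_integral_backlog add_left_mono)
qed

section \<open>Expectations under a fixed feasible policy\<close>

context
  fixes \<pi> :: "'m policy"
  assumes \<pi>: "feasible_policy I \<pi>"
begin

text \<open>This is the factor of the increase of j in \<open>sum_incr_le\<close>. By decoupling,
  the processing time is averaged with the machine held fixed, so the left-hand side there averages
  to the sum of the increases, that is, to ALG.\<close>

lemma nn_integral_ptime_over_mean:
  assumes j: "j \<in> jobs I"
  shows "(\<integral>\<^sup>+\<omega>. ennreal (real (ptime I (machine I \<pi> j \<omega>) j \<omega>)) / mean I (machine I \<pi> j \<omega>) j \<partial>probs I) = 1"
proof -
  have "(\<integral>\<^sup>+\<omega>. ennreal (real (ptime I (machine I \<pi> j \<omega>) j \<omega>)) / mean I (machine I \<pi> j \<omega>) j \<partial>probs I) =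
    (\<integral>\<^sup>+\<omega>. \<integral>\<^sup>+\<omega>'. ennreal (real (ptime I (machine I \<pi> j \<omega>) j \<omega>')) / mean I (machine I \<pi> j \<omega>) j \<partial>probs I \<partial>probs I)"
    by (rule nn_integral_decoupling[OF valid \<pi> j, of "\<lambda>t i n. ennreal (real n) / mean I i j"])
  also have "\<dots> = (\<integral>\<^sup>+\<omega>. 1 \<partial>probs I)"
  proof (rule nn_integral_cong)
    fix \<omega> assume "\<omega> \<in> space (probs I)"
    then have i: "machine I \<pi> j \<omega> \<in> eligible I j" (is "?i \<in> _")
      by (rule machine_eligible[OF \<pi> _ j])
    have "ptime I ?i j \<in> measurable (probs I) (count_space UNIV)"
      by (rule measurable_ptime[OF j i])
    then have "(\<integral>\<^sup>+\<omega>'. ennreal (real (ptime I ?i j \<omega>')) / mean I ?i j \<partial>probs I) = mean I ?i j / mean I ?i j"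
      by (simp add: mean_def ennreal_of_nat_eq_real_of_nat nn_integral_divide)
    also have "\<dots> = 1"
      using mean_pos[OF j i] mean_finite[OF i] by simp
    finally show "(\<integral>\<^sup>+\<omega>'. ennreal (real (ptime I ?i j \<omega>')) / mean I ?i j \<partial>probs I) = 1" .
  qed
  finally show ?thesis
    by (simp add: emeasure_space_1)
qed

lemma nn_integral_policy_completion:
  assumes j: "j \<in> jobs I"
  shows "(\<integral>\<^sup>+\<omega>. ennreal (policy_completion I \<pi> \<omega> j) \<partial>probs I) =
    (\<integral>\<^sup>+\<omega>. ennreal (start_time I \<pi> j \<omega>) + mean I (machine I \<pi> j \<omega>) j \<partial>probs I)"
proof -
  have "(\<integral>\<^sup>+\<omega>. ennreal (policy_completion I \<pi> \<omega> j) \<partial>probs I) =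
    (\<integral>\<^sup>+\<omega>. ennreal (start_time I \<pi> j \<omega>) + of_nat (ptime I (machine I \<pi> j \<omega>) j \<omega>) \<partial>probs I)"
    using start_time_nonneg[OF \<pi> _ j]
    by (intro nn_integral_cong) (simp add: policy_completion_eq[OF \<pi> _ j] ennreal_of_nat_eq_real_of_nat)
  also have "\<dots> = (\<integral>\<^sup>+\<omega>. \<integral>\<^sup>+\<omega>'. ennreal (start_time I \<pi> j \<omega>) +
      of_nat (ptime I (machine I \<pi> j \<omega>) j \<omega>') \<partial>probs I \<partial>probs I)"
    by (rule nn_integral_decoupling[OF valid \<pi> j, of "\<lambda>t i n. ennreal t + of_nat n"])
  also have "\<dots> = (\<integral>\<^sup>+\<omega>. ennreal (start_time I \<pi> j \<omega>) + mean I (machine I \<pi> j \<omega>) j \<partial>probs I)"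
  proof (rule nn_integral_cong)
    fix \<omega> assume "\<omega> \<in> space (probs I)"
    then have i: "machine I \<pi> j \<omega> \<in> eligible I j" (is "?i \<in> _")
      by (rule machine_eligible[OF \<pi> _ j])
    have "ptime I ?i j \<in> measurable (probs I) (count_space UNIV)"
      by (rule measurable_ptime[OF j i])
    then show "(\<integral>\<^sup>+\<omega>'. ennreal (start_time I \<pi> j \<omega>) + of_nat (ptime I ?i j \<omega>') \<partial>probs I) =
        ennreal (start_time I \<pi> j \<omega>) + mean I ?i j"
      by (subst nn_integral_add) (simp_all add: mean_def emeasure_space_1)
  qed
  finally show ?thesis .
qed

text \<open>With start t of j and its mean m on the chosen machine, the three terms average to m, 2
  t and at most (1 + Delta) m. Their sum is at most (2 + Delta) (t + m), and t + m averages to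
  E[C_j] by \<open>nn_integral_policy_completion\<close>.\<close>

lemma nn_integral_rate_cost_le:
  assumes j: "j \<in> jobs I"
  defines "p \<equiv> \<lambda>\<omega>. real (ptime I (machine I \<pi> j \<omega>) j \<omega>)"
  shows "(\<integral>\<^sup>+\<omega>. ennreal (p \<omega>) +
      ennreal (2 * start_time I \<pi> j \<omega> * p \<omega> + (p \<omega>)\<^sup>2) / mean I (machine I \<pi> j \<omega>) j \<partial>probs I) \<le>
    (2 + Delta I) * (\<integral>\<^sup>+\<omega>. ennreal (policy_completion I \<pi> \<omega> j) \<partial>probs I)"
proof -
  define f where "f t i n = ennreal (real n) + ennreal (2 * t * real n + (real n)\<^sup>2) / mean I i j"
    for t i n
  let ?t = "start_time I \<pi> j" and ?\<mu> = "machine I \<pi> j"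
  have "(\<integral>\<^sup>+\<omega>. ennreal (p \<omega>) + ennreal (2 * ?t \<omega> * p \<omega> + (p \<omega>)\<^sup>2) / mean I (?\<mu> \<omega>) j \<partial>probs I) =
      (\<integral>\<^sup>+\<omega>. f (?t \<omega>) (?\<mu> \<omega>) (ptime I (?\<mu> \<omega>) j \<omega>) \<partial>probs I)"
    by (simp add: f_def p_def)
  also have "\<dots> = (\<integral>\<^sup>+\<omega>. \<integral>\<^sup>+\<omega>'. f (?t \<omega>) (?\<mu> \<omega>) (ptime I (?\<mu> \<omega>) j \<omega>') \<partial>probs I \<partial>probs I)"
    by (rule nn_integral_decoupling[OF valid \<pi> j])
  also have "\<dots> \<le> (\<integral>\<^sup>+\<omega>. (2 + Delta I) * (ennreal (?t \<omega>) + mean I (?\<mu> \<omega>) j) \<partial>probs I)"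
  proof (rule nn_integral_mono)
    fix \<omega> assume \<omega>: "\<omega> \<in> space (probs I)"
    define i where "i = ?\<mu> \<omega>"
    define t where "t = ?t \<omega>"
    have i: "i \<in> eligible I j" and t: "0 \<le> t"
      using machine_eligible[OF \<pi> \<omega> j] start_time_nonneg[OF \<pi> \<omega> j] by (simp_all add: i_def t_def)
    let ?P = "\<lambda>\<omega>. real (ptime I i j \<omega>)" and ?m = "mean I i j"
    have m: "?m \<noteq> 0" "?m < top"
      using mean_pos[OF j i] mean_finite[OF i] by auto
    have [measurable]: "?P \<in> borel_measurable (probs I)"
      using measurable_ptime[OF j i] by (rule measurable_compose) simp
    have mP: "(\<integral>\<^sup>+\<omega>. ennreal (?P \<omega>) \<partial>probs I) = ?m"
      by (simp add: mean_def ennreal_of_nat_eq_real_of_nat)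
    have "(\<integral>\<^sup>+\<omega>'. f t i (ptime I i j \<omega>') \<partial>probs I) =
        (\<integral>\<^sup>+\<omega>'. ennreal (?P \<omega>') +
          (ennreal (2 * t) * ennreal (?P \<omega>') / ?m + ennreal ((?P \<omega>')\<^sup>2) / ?m) \<partial>probs I)"
      unfolding f_def using t
      by (intro nn_integral_cong) (simp add: ennreal_mult add_divide_distrib_ennreal)
    also have "\<dots> = ?m + (ennreal (2 * t) * ?m / ?m + (\<integral>\<^sup>+\<omega>'. ennreal ((?P \<omega>')\<^sup>2) \<partial>probs I) / ?m)"
      by (simp add: nn_integral_add nn_integral_divide nn_integral_cmult mP)
    also have "\<dots> \<le> ?m + (ennreal (2 * t) + (1 + Delta I) * ?m)"
      using m by (intro add_mono second_moment_le j i) (simp_all add: mult_divide_eq_ennreal)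
    also have "\<dots> \<le> (2 + Delta I) * (ennreal t + ?m)"
    proof -
      have "?m + (1 + Delta I) * ?m = (1 + 1 + Delta I) * ?m"
        by (simp only: distrib_right mult_1_left add.assoc)
      then have "?m + (ennreal (2 * t) + (1 + Delta I) * ?m) = 2 * ennreal t + (2 + Delta I) * ?m"
        using t by (simp add: ennreal_mult add.left_commute)
      also have "\<dots> \<le> (2 + Delta I) * ennreal t + (2 + Delta I) * ?m"
        by (intro add_mono mult_right_mono) auto
      finally show ?thesis
        by (simp add: distrib_left)
    qed
    finally show "(\<integral>\<^sup>+\<omega>'. f (?t \<omega>) (?\<mu> \<omega>) (ptime I (?\<mu> \<omega>) j \<omega>') \<partial>probs I) \<le>
        (2 + Delta I) * (ennreal (?t \<omega>) + mean I (?\<mu> \<omega>) j)"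
      by (simp add: i_def t_def)
  qed
  also have "\<dots> = (2 + Delta I) * (\<integral>\<^sup>+\<omega>. ennreal (policy_completion I \<pi> \<omega> j) \<partial>probs I)"
  proof -
    have "(\<lambda>\<omega>. ennreal (?t \<omega>) + mean I (?\<mu> \<omega>) j) \<in> borel_measurable (probs I)"
      by (rule measurable_decoupling[OF valid \<pi> j, of "\<lambda>t i n. ennreal t + mean I i j"])
    then show ?thesis
      by (simp add: nn_integral_policy_completion[OF j] nn_integral_cmult)
  qed
  finally show ?thesis .
qed

lemma policy_cost_eq:
  "policy_cost I \<pi> = (\<Sum>j\<in>jobs I. w j * (\<integral>\<^sup>+\<omega>. ennreal (policy_completion I \<pi> \<omega> j) \<partial>probs I))"
proof -
  have nonneg: "0 \<le> policy_completion I \<pi> \<omega> j" if "j \<in> jobs I" "\<omega> \<in> space (probs I)" for j \<omega>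
    using that start_time_nonneg[OF \<pi> that(2,1)] by (simp add: policy_completion_eq[OF \<pi>])
  have meas: "(\<lambda>\<omega>. ennreal (policy_completion I \<pi> \<omega> j)) \<in> borel_measurable (probs I)"
    if j: "j \<in> jobs I" for j
    using measurable_decoupling[OF valid \<pi> j, of "\<lambda>t i n. ennreal (t + real n)"]
    by (simp add: policy_completion_eq[OF \<pi> _ j] cong: measurable_cong)
  have "policy_cost I \<pi> = (\<integral>\<^sup>+\<omega>. (\<Sum>j\<in>jobs I. w j * ennreal (policy_completion I \<pi> \<omega> j)) \<partial>probs I)"
    unfolding policy_cost_def
  proof (rule nn_integral_cong)
    fix \<omega> assume \<omega>: "\<omega> \<in> space (probs I)"
    have "ennreal (\<Sum>j\<in>jobs I. weight I j * policy_completion I \<pi> \<omega> j) =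
        (\<Sum>j\<in>jobs I. ennreal (weight I j * policy_completion I \<pi> \<omega> j))"
      using \<omega> by (intro sum_ennreal[symmetric] mult_nonneg_nonneg weight_nonneg nonneg)
    also have "\<dots> = (\<Sum>j\<in>jobs I. w j * ennreal (policy_completion I \<pi> \<omega> j))"
      unfolding w_def using \<omega> by (intro sum.cong refl ennreal_mult weight_nonneg nonneg)
    finally show "ennreal (\<Sum>j\<in>jobs I. weight I j * policy_completion I \<pi> \<omega> j) =
        (\<Sum>j\<in>jobs I. w j * ennreal (policy_completion I \<pi> \<omega> j))" .
  qed
  also have "\<dots> = (\<Sum>j\<in>jobs I. w j * (\<integral>\<^sup>+\<omega>. ennreal (policy_completion I \<pi> \<omega> j) \<partial>probs I))"
    using meas by (simp add: nn_integral_sum nn_integral_cmult)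
  finally show ?thesis .
qed

lemma ALG_le_policy_cost: "ALG I a \<le> (4 + 2 * Delta I) * policy_cost I \<pi>"
proof -
  let ?m = "\<lambda>j \<omega>. mean I (machine I \<pi> j \<omega>) j"
  let ?p = "\<lambda>j \<omega>. real (ptime I (machine I \<pi> j \<omega>) j \<omega>)"
  let ?c = "\<lambda>j \<omega>. ennreal (?p j \<omega>) + ennreal (2 * start_time I \<pi> j \<omega> * ?p j \<omega> + (?p j \<omega>)\<^sup>2) / ?m j \<omega>"
  have meas: "(\<lambda>\<omega>. ennreal (?p j \<omega>) / ?m j \<omega>) \<in> borel_measurable (probs I)"
      "?c j \<in> borel_measurable (probs I)" if j: "j \<in> jobs I" for j
    using measurable_decoupling[OF valid \<pi> j, of "\<lambda>t i n. ennreal (real n) / mean I i j"]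
      measurable_decoupling[OF valid \<pi> j, of "\<lambda>t i n. ennreal (real n) +
        ennreal (2 * t * real n + (real n)\<^sup>2) / mean I i j"] by simp_all
  have A: "ALG I a = (\<Sum>j\<in>jobs I. incr I a j (a j))"
    by (simp add: ALG_eq sum_end_time_eq_sum_incr)
  also have "\<dots> = (\<Sum>j\<in>jobs I. \<integral>\<^sup>+\<omega>. incr I a j (a j) * (ennreal (?p j \<omega>) / ?m j \<omega>) \<partial>probs I)"
    using meas by (simp add: nn_integral_cmult nn_integral_ptime_over_mean)
  also have "\<dots> = (\<integral>\<^sup>+\<omega>. (\<Sum>j\<in>jobs I. incr I a j (a j) * (ennreal (?p j \<omega>) / ?m j \<omega>)) \<partial>probs I)"
    using meas by (intro nn_integral_sum[symmetric]) simp
  also have "\<dots> \<le> (\<integral>\<^sup>+\<omega>. (\<Sum>j\<in>jobs I. w j * ?c j \<omega>) + ALG I a / 2 \<partial>probs I)"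
    by (intro nn_integral_mono sum_incr_le \<pi>)
  also have "\<dots> = (\<Sum>j\<in>jobs I. w j * (\<integral>\<^sup>+\<omega>. ?c j \<omega> \<partial>probs I)) + ALG I a / 2"
    using meas by (simp add: nn_integral_add nn_integral_sum nn_integral_cmult emeasure_space_1)
  also have "(\<Sum>j\<in>jobs I. w j * (\<integral>\<^sup>+\<omega>. ?c j \<omega> \<partial>probs I)) \<le>
      (\<Sum>j\<in>jobs I. w j * ((2 + Delta I) * (\<integral>\<^sup>+\<omega>. ennreal (policy_completion I \<pi> \<omega> j) \<partial>probs I)))"
    by (intro sum_mono mult_left_mono nn_integral_rate_cost_le) auto
  also have "\<dots> = (2 + Delta I) * policy_cost I \<pi>"
    by (simp add: policy_cost_eq sum_distrib_left mult.left_commute)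
  finally have "ALG I a \<le> (2 + Delta I) * policy_cost I \<pi> + ALG I a / 2"
    by (simp add: add_right_mono)
  \<comment> \<open>Finiteness permits cancelling ALG / 2 on both sides, which doubles the factor 2
    + Delta.\<close>
  moreover have "ALG I a < top"
    unfolding ALG_eq by (simp add: w_def ennreal_mult_less_top end_time_finite)
  moreover have "x \<le> 2 * y" if xy: "x \<le> y + x / 2" "x < top" for x y :: ennreal
  proof (cases y)
    case (real u)
    moreover from xy(2) obtain v where v: "x = ennreal v" "0 \<le> v"
      by (cases x) auto
    ultimately have "ennreal v \<le> ennreal (u + v / 2)"
      using xy(1) by (simp add: ennreal_divide_numeral)
    then have "v \<le> u + v / 2"
      using real v by (subst (asm) ennreal_le_iff) auto
    then have "ennreal v \<le> ennreal (2 * u)"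
      by (intro ennreal_leI) simp
    with real v show ?thesis
      by (simp add: ennreal_mult)
  qed (simp add: ennreal_mult_top)
  ultimately have "ALG I a \<le> 2 * ((2 + Delta I) * policy_cost I \<pi>)"
    by blast
  also have "\<dots> = (4 + 2 * Delta I) * policy_cost I \<pi>"
    by (simp add: mult.assoc[symmetric] distrib_left)
  finally show ?thesis .
qed

text \<open>A bound common to all policies: the optimum is an infimum, so positivity of each single
  cost would not make it positive. Any policy spends on j, in expectation, at least the smallest of
  its finitely many eligible means.\<close>

lemma weighted_Min_mean_le_policy_cost:
  assumes j: "j \<in> jobs I"
  shows "w j * Min ((\<lambda>i. mean I i j) ` eligible I j) \<le> policy_cost I \<pi>"
proof -
  let ?M = "Min ((\<lambda>i. mean I i j) ` eligible I j)"
  have fin: "finite (eligible I j)"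
    using valid by (simp add: valid_inst_def eligible_def)
  have "?M = (\<integral>\<^sup>+\<omega>. ?M \<partial>probs I)"
    by (simp add: emeasure_space_1)
  also have "\<dots> \<le> (\<integral>\<^sup>+\<omega>. ennreal (start_time I \<pi> j \<omega>) + mean I (machine I \<pi> j \<omega>) j \<partial>probs I)"
    using fin machine_eligible[OF \<pi> _ j]
    by (intro nn_integral_mono add_increasing) (auto intro: Min_le)
  also have "\<dots> = (\<integral>\<^sup>+\<omega>. ennreal (policy_completion I \<pi> \<omega> j) \<partial>probs I)"
    by (simp add: nn_integral_policy_completion[OF j])
  finally have "w j * ?M \<le> w j * (\<integral>\<^sup>+\<omega>. ennreal (policy_completion I \<pi> \<omega> j) \<partial>probs I)"
    by (rule mult_left_mono) simp
  also have "\<dots> \<le> policy_cost I \<pi>"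
    unfolding policy_cost_eq using j
    by (intro member_le_sum[where f = "\<lambda>j. w j * (\<integral>\<^sup>+\<omega>. ennreal (policy_completion I \<pi> \<omega> j) \<partial>probs I)"]) auto
  finally show ?thesis .
qed

end

text \<open>If \<open>Delta I\<close> is infinite, the claim reduces to the positivity of the optimum.\<close>

lemma OPT_pos:
  assumes "ALG I a \<noteq> 0"
  shows "0 < OPT I"
proof -
  from assms obtain j where j: "j \<in> jobs I" "w j \<noteq> 0"
    by (auto simp: ALG_eq)
  let ?M = "Min ((\<lambda>i. mean I i j) ` eligible I j)"
  have "finite (eligible I j)" "eligible I j \<noteq> {}"
    using valid assigned_eligible[OF j(1)] by (auto simp: valid_inst_def eligible_def)
  then have "?M \<noteq> 0"
    using mean_pos[OF j(1)] by (auto simp: Min_gr_iff simp flip: zero_less_iff_neq_zero)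
  with j(2) have "0 < w j * ?M"
    by (simp add: zero_less_iff_neq_zero)
  also have "\<dots> \<le> OPT I"
    unfolding OPT_def using j(1) by (auto intro: INF_greatest weighted_Min_mean_le_policy_cost)
  finally show ?thesis .
qed

lemma competitive: "ALG I a \<le> (4 + 2 * Delta I) * OPT I"
proof (cases "Delta I = top")
  case True
  then have top: "4 + 2 * Delta I = top"
    by (simp add: ennreal_mult_top)
  show ?thesis
  proof (cases "ALG I a = 0")
    case False
    with OPT_pos have "(4 + 2 * Delta I) * OPT I = top"
      unfolding top by (simp add: ennreal_top_mult)
    then show ?thesis by simp
  qed simp
next
  case False
  define c where "c = 4 + 2 * Delta I"
  have c: "c \<noteq> 0" "c < top"
    using False by (auto simp: c_def ennreal_mult_less_top less_top)
  \<comment> \<open>For finite nonzero c the claim is a lower bound on the cost of every policy, and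
    such a bound passes to the infimum.\<close>
  have "ALG I a / c \<le> OPT I"
    unfolding OPT_def
  proof (rule INF_greatest)
    fix \<pi> assume "\<pi> \<in> {\<pi>. feasible_policy I \<pi>}"
    then show "ALG I a / c \<le> policy_cost I \<pi>"
      using ALG_le_policy_cost[of \<pi>] c
      by (intro divide_le_posI_ennreal) (auto simp: c_def zero_less_iff_neq_zero)
  qed
  then have "c * (ALG I a / c) \<le> c * OPT I"
    by (rule mult_left_mono) simp
  moreover have "c * (ALG I a / c) = ALG I a"
    using c by (simp add: ennreal_times_divide mult.commute[of c] mult_divide_eq_ennreal)
  ultimately show ?thesis
    by (simp add: c_def)
qed

end

theorem theorem1:
  fixes I :: "('a, 'm) sched_inst" and a :: "nat \<Rightarrow> 'm"
  assumes "valid_inst I" and "greedy_assignment I a"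
  shows "ALG I a \<le> (4 + 2 * Delta I) * OPT I"
  using assms by (intro greedy.competitive greedy.intro)

end
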